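(* Let $n \geq 4$, and read indices cyclically modulo $n$ (so $X_{n+1}=X_1$, $X_{n+2}=X_2$). (1) Let $X = (X_1,\dots,X_n) \sim \mathcal{N}(\mu,\Sigma)$ with $\mu\in\mathbb{R}^n$ and $\Sigma$ an $n\times n$ positive definite matrix. Suppose that $X$ satisfies the $n$ conditional independence constraints $$X_1 \perp\!\!\!\perp X_2 \mid X_3,\quad X_2 \perp\!\!\!\perp X_3 \mid X_4,\quad \ldots,\quad X_{n-1} \perp\!\!\!\perp X_n \mid X_1,\quad X_n \perp\!\!\!\perp X_1 \mid X_2,$$ i.e. $X_i \perp\!\!\!\perp X_{i+1} \mid X_{i+2}$ for all $i \in\{1,\dots,n\}$. Then $X$ also satisfies the $n$ marginal independence constraints $$X_1 \perp\!\!\!\perp X_2,\quad X_2 \perp\!\!\!\perp X_3,\quad \ldots,\quad X_{n-1} \perp\!\!\!\perp X_n,\quad X_1 \perp\!\!\!\perp X_n.$$ (2) For every proper subset $S \subsetneq \{1,\dots,n\}$ there exists a Gaussian random vector $X=(X_1,\dots,X_n) \sim \mathcal{N}(\mu,\Sigma)$ with $\Sigma$ positive definite such that $X_i \perp\!\!\!\perp X_{i+1} \mid X_{i+2}$ holds for every $i \in S$, while none of the marginal independences $X_i \perp\!\!\!\perp X_{i+1}$, $i\in\{1,\dots,n\}$, holds.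
   Context: $\mathcal{N}(\mu,\Sigma)$ denotes the multivariate Gaussian distribution on $\mathbb{R}^n$ with mean $\mu$ and covariance matrix $\Sigma$. $X_i \perp\!\!\!\perp X_j \mid X_k$ means that $X_i$ and $X_j$ are conditionally independent given $X_k$; $X_i \perp\!\!\!\perp X_j$ means that $X_i$ and $X_j$ are independent. *)

theory Defs
  imports "HOL-Probability.Probability"
    "Jordan_Normal_Form.Determinant" "Jordan_Normal_Form.Gauss_Jordan_Elimination"
begin

unbundle no inner_syntax
unbundle no vec_syntax

text \<open>Symmetry is included, as usual for real positive definite matrices.\<close>

definition positive_definite_mat :: "real mat \<Rightarrow> bool" where
  "positive_definite_mat A \<longleftrightarrow> square_mat A \<and> transpose_mat A = A \<and>
     (\<forall>v \<in> carrier_vec (dim_row A). v \<noteq> 0\<^sub>v (dim_row A) \<longrightarrow> v \<bullet> (A *\<^sub>v v) > 0)"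

text \<open>Only meaningful for a positive definite \<open>S\<close> whose dimension is that of \<open>m\<close>;
  then \<open>S\<close> is invertible, so \<open>mat_inverse S\<close> is not \<open>None\<close>.\<close>

definition mv_normal_density :: "real vec \<Rightarrow> real mat \<Rightarrow> real vec \<Rightarrow> real" where
  "mv_normal_density m S x =
     1 / sqrt ((2 * pi) ^ dim_vec m * Determinant.det S) *
     exp (- ((x - m) \<bullet> (the (mat_inverse S) *\<^sub>v (x - m))) / 2)"

text \<open>\<open>X 0, ..., X (n - 1)\<close> are the components of a random vector; Lebesgue measure on
  $n$-space is the product measure on \<open>{..<n} \<rightarrow>\<^sub>E UNIV\<close>.\<close>

definition gaussian_vector ::
  "'a measure \<Rightarrow> nat \<Rightarrow> (nat \<Rightarrow> 'a \<Rightarrow> real) \<Rightarrow> real vec \<Rightarrow> real mat \<Rightarrow> bool" where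
  "gaussian_vector M n X m S \<longleftrightarrow>
     m \<in> carrier_vec n \<and> S \<in> carrier_mat n n \<and> positive_definite_mat S \<and>
     distributed M (\<Pi>\<^sub>M i\<in>{..<n}. lborel) (\<lambda>\<omega>. \<lambda>i\<in>{..<n}. X i \<omega>)
       (\<lambda>x. ennreal (mv_normal_density m S (Matrix.vec n x)))"

text \<open>Conditional independence of \<open>X\<close> and \<open>Y\<close> given the $\sigma$-algebra generated by \<open>Z\<close>:
  $P(X \in A, Y \in B \mid Z) = P(X \in A \mid Z)\, P(Y \in B \mid Z)$ almost surely,
  for all Borel sets \<open>A\<close>, \<open>B\<close>.\<close>

definition cond_indep_var ::
  "'a measure \<Rightarrow> ('a \<Rightarrow> real) \<Rightarrow> ('a \<Rightarrow> real) \<Rightarrow> ('a \<Rightarrow> real) \<Rightarrow> bool" where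
  "cond_indep_var M X Y Z \<longleftrightarrow>
     X \<in> borel_measurable M \<and> Y \<in> borel_measurable M \<and> Z \<in> borel_measurable M \<and>
     (let F = vimage_algebra (space M) Z borel in
      \<forall>A \<in> sets borel. \<forall>B \<in> sets borel. AE \<omega> in M.
        real_cond_exp M F (\<lambda>\<omega>. indicator A (X \<omega>) * indicator B (Y \<omega>)) \<omega> =
        real_cond_exp M F (\<lambda>\<omega>. indicator A (X \<omega>)) \<omega> *
        real_cond_exp M F (\<lambda>\<omega>. indicator B (Y \<omega>)) \<omega>)"

end

theory Submission
  imports Defs
begin

text \<open>Write \<open>P\<close> for the inverse covariance matrix. Completing the square in the last variable \<open>X r\<close>
  of a Gaussian family splits it as a linear function of the others plus an independent centred normal
  residual of variance \<open>1 / P r r\<close>, and leaves a Gaussian family whose inverse covariance is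
  the Schur complement of \<open>P\<close>. Repeating this down to three variables expresses \<open>X i\<close> and \<open>X j\<close>
  as multiples of \<open>X k\<close> plus a pair independent of \<open>X k\<close>; conditional independence given \<open>X k\<close> amounts to
  independence of that pair, hence to \<open>S i j * S k k = S i k * S j k\<close>.

  For squared correlations the constraints read \<open>r i (i+1) = r i (i+2) * r (i+1) (i+2)\<close> with
  \<open>r i (i+2) < 1\<close>, so a largest \<open>r i (i+1)\<close> on the cycle has to vanish. If the constraint at one index is
  dropped, the remaining ones can be solved along the resulting path by a small perturbation of the identity.\<close>

section \<open>Positive definite forms and Schur complements\<close>

text \<open>The inverse covariance \<open>P\<close> and the covariance \<open>S\<close> travel
  together because each is simple where the other is not. The density is explicit in
  \<open>P\<close>, and eliminating a variable turns \<open>P\<close> into a Schur complement,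
  whereas \<open>S\<close> merely loses a row and a column. So \<open>inverse_on\<close> persists
  with one and the same \<open>S\<close>, and the vanishing of an entry of \<open>P\<close> is
  translated into a condition on \<open>S\<close> only for two or three variables, where it is a
  short elimination. Normalising constants stay anonymous until Gaussian vectors have to be
  constructed.

  The obstacle on the probabilistic side is that conditional independence is an almost sure
  statement whose exceptional set depends on the two Borel sets. Testing on rational half-lines
  leaves countably many exceptional sets, so there is one value \<open>z\<close> of the conditioning
  variable at which all the product formulas hold. There the variables are the residuals shifted by
  constants, and independence ignores such shifts.\<close>

definition quad :: "'i set \<Rightarrow> ('i \<Rightarrow> 'i \<Rightarrow> real) \<Rightarrow> ('i \<Rightarrow> real) \<Rightarrow> real" where
  "quad I P v = (\<Sum>i\<in>I. \<Sum>j\<in>I. P i j * v i * v j)"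

definition pos_def_on :: "'i set \<Rightarrow> ('i \<Rightarrow> 'i \<Rightarrow> real) \<Rightarrow> bool" where
  "pos_def_on I P \<longleftrightarrow> (\<forall>i\<in>I. \<forall>j\<in>I. P i j = P j i) \<and>
     (\<forall>v. (\<exists>i\<in>I. v i \<noteq> 0) \<longrightarrow> 0 < quad I P v)"

text \<open>Functions on an arbitrary index set, rather than matrices, let every submatrix be
  denoted by the same \<open>S\<close>: dropping variables needs no reindexing.\<close>

definition inverse_on :: "'i set \<Rightarrow> ('i \<Rightarrow> 'i \<Rightarrow> real) \<Rightarrow> ('i \<Rightarrow> 'i \<Rightarrow> real) \<Rightarrow> bool" where
  "inverse_on I P S \<longleftrightarrow> (\<forall>i\<in>I. \<forall>k\<in>I. (\<Sum>j\<in>I. P i j * S j k) = (if i = k then 1 else 0))"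

definition schur :: "'i \<Rightarrow> ('i \<Rightarrow> 'i \<Rightarrow> real) \<Rightarrow> 'i \<Rightarrow> 'i \<Rightarrow> real" where
  "schur r P i j = P i j - P i r * P r j / P r r"

lemma quad_cong:
  "(\<And>i. i \<in> I \<Longrightarrow> v i = w i) \<Longrightarrow> quad I P v = quad I P w"
  by (simp add: quad_def)

lemma pos_def_on_sym: "pos_def_on I P \<Longrightarrow> i \<in> I \<Longrightarrow> j \<in> I \<Longrightarrow> P i j = P j i"
  by (auto simp: pos_def_on_def)

lemma pos_def_on_pos: "pos_def_on I P \<Longrightarrow> i \<in> I \<Longrightarrow> v i \<noteq> 0 \<Longrightarrow> 0 < quad I P v"
  by (auto simp: pos_def_on_def)

lemma pos_def_on_subset:
  assumes "pos_def_on I P" "J \<subseteq> I" "finite I"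
  shows "pos_def_on J P"
  unfolding pos_def_on_def
proof (intro conjI ballI allI impI)
  fix v :: "'a \<Rightarrow> real" assume v: "\<exists>i\<in>J. v i \<noteq> 0"
  define w where "w i = (if i \<in> J then v i else 0)" for i
  have "0 < quad I P w"
    using v assms(2) by (auto intro!: pos_def_on_pos[OF assms(1)] simp: w_def)
  also have "quad I P w = quad J P w"
    unfolding quad_def using assms
    by (intro sum.mono_neutral_cong_right ballI) (auto simp: w_def intro!: sum.mono_neutral_right finite_subset)
  also have "\<dots> = quad J P v" by (rule quad_cong) (simp add: w_def)
  finally show "0 < quad J P v" .
qed (use assms(1,2) pos_def_on_sym[OF assms(1)] in blast)

lemma pos_def_on_diag:
  assumes "pos_def_on I P" "i \<in> I" "finite I" shows "0 < P i i"
proof -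
  have "0 < quad {i} P (\<lambda>_. 1)"
    using pos_def_on_subset[OF assms(1), of "{i}"] assms by (auto intro: pos_def_on_pos[of _ _ i])
  then show ?thesis by (simp add: quad_def)
qed

lemma pos_def_on_minor:
  assumes "pos_def_on I P" "i \<in> I" "j \<in> I" "i \<noteq> j" "finite I"
  shows "(P i j)\<^sup>2 < P i i * P j j"
proof -
  have ij: "pos_def_on {i, j} P" using pos_def_on_subset[OF assms(1)] assms by auto
  have sym: "P j i = P i j" using pos_def_on_sym[OF assms(1)] assms by blast
  have pos: "0 < P i i" using pos_def_on_diag[OF assms(1)] assms by blast
  \<comment> \<open>This test vector makes the \<open>i\<close>-th entry of \<open>P v\<close>
    vanish, so that the form reduces to \<open>P i i\<close> times the 2x2 determinant.\<close>
  define v where "v l = (if l = i then - P i j else P i i)" for l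
  have "0 < quad {i, j} P v"
    using pos by (intro pos_def_on_pos[OF ij, of j]) (auto simp: v_def)
  also have "\<dots> = P i i * (P i i * P j j - (P i j)\<^sup>2)"
    using assms(4) by (simp add: quad_def v_def sym algebra_simps power2_eq_square)
  finally show ?thesis using pos by (simp add: zero_less_mult_iff)
qed

text \<open>Completing the square in the coordinate \<open>r\<close>; the cross terms that the
  square adds among the other coordinates are what the Schur complement subtracts.\<close>

lemma quad_insert:
  assumes I: "finite I" "r \<notin> I" and sym: "\<And>i. i \<in> I \<Longrightarrow> P i r = P r i" and nz: "P r r \<noteq> 0"
  shows "quad (insert r I) P v =
    P r r * (v r + (\<Sum>i\<in>I. P r i / P r r * v i))\<^sup>2 + quad I (schur r P) v"
proof -
  define s where "s = (\<Sum>i\<in>I. P r i * v i)"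
  have 1: "(\<Sum>i\<in>I. P r i / P r r * v i) = s / P r r"
    by (simp add: s_def sum_divide_distrib)
  have 2: "(\<Sum>i\<in>I. P i r * v i * v r) = s * v r" 
    unfolding s_def sum_distrib_right by (intro sum.cong) (auto simp: sym)
  have 3: "(\<Sum>j\<in>I. P r j * v r * v j) = s * v r" 
    unfolding s_def sum_distrib_right by (intro sum.cong) auto
  have 4: "(\<Sum>i\<in>I. \<Sum>j\<in>I. P i r * P r j / P r r * v i * v j) = s * s / P r r"
    unfolding s_def sum_product sum_divide_distrib by (intro sum.cong) (auto simp: sym)
  have "quad I (schur r P) v = quad I P v - s * s / P r r"
    unfolding 4[symmetric] quad_def schur_def left_diff_distrib sum_subtractf ..
  moreover have "quad (insert r I) P v = P r r * v r * v r + 2 * s * v r + quad I P v"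
    unfolding quad_def sum.insert[OF I] sum.distrib 2 3 by simp
  moreover have "P r r * (v r + s / P r r)\<^sup>2 = P r r * v r * v r + 2 * s * v r + s * s / P r r"
    using nz by (simp add: field_simps power2_eq_square)
  ultimately show ?thesis unfolding 1 by simp
qed

lemma pos_def_on_schur:
  assumes P: "pos_def_on (insert r I) P" and I: "finite I" "r \<notin> I"
  shows "pos_def_on I (schur r P)"
  unfolding pos_def_on_def
proof (intro conjI ballI allI impI)
  fix v :: "'a \<Rightarrow> real" assume v: "\<exists>i\<in>I. v i \<noteq> 0"
  \<comment> \<open>The value at \<open>r\<close> minimises the form for given remaining
    coordinates: the completed square vanishes, and what is left is the Schur form.\<close>
  define w where "w = v(r := - (\<Sum>i\<in>I. P r i / P r r * v i))"
  have *: "w i = v i" if "i \<in> I" for i using that I by (auto simp: w_def)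
  have pos: "0 < P r r" using pos_def_on_diag[OF P] I by auto
  obtain i where "i \<in> I" "v i \<noteq> 0" using v by blast
  then have "0 < quad (insert r I) P w"
    by (intro pos_def_on_pos[OF P, of i]) (auto simp: *)
  also have "quad (insert r I) P w = P r r * (w r + (\<Sum>i\<in>I. P r i / P r r * w i))\<^sup>2 + quad I (schur r P) w"
    using I pos pos_def_on_sym[OF P] by (intro quad_insert) auto
  also have "(\<Sum>i\<in>I. P r i / P r r * w i) = (\<Sum>i\<in>I. P r i / P r r * v i)"
    by (simp add: *)
  also have "w r + \<dots> = 0" by (simp add: w_def)
  also have "quad I (schur r P) w = quad I (schur r P) v" by (rule quad_cong) (rule *)
  finally show "0 < quad I (schur r P) v" by simp
next
  fix i j assume "i \<in> I" "j \<in> I"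
  then have "P i j = P j i" "P i r = P r i" "P r j = P j r"
    using pos_def_on_sym[OF P] by blast+
  then show "schur r P i j = schur r P j i" by (simp add: schur_def)
qed

text \<open>Block elimination: row \<open>r\<close> of \<open>P S = 1\<close> expresses the sum over
  \<open>I\<close> through \<open>S r k\<close>, and inserting this into the other rows leaves the
  Schur complement. Since \<open>S\<close> does not change, passing to a marginal distribution keeps
  the covariances.\<close>

lemma inverse_on_schur:
  assumes inv: "inverse_on (insert r I) P S" and I: "finite I" "r \<notin> I" and nz: "P r r \<noteq> 0"
  shows "inverse_on I (schur r P) S"
  unfolding inverse_on_def
proof (intro ballI)
  fix i k assume ik: "i \<in> I" "k \<in> I"
  have "(\<Sum>j\<in>insert r I. P i j * S j k) = (if i = k then 1 else 0)"
    using inv ik unfolding inverse_on_def by blast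
  then have "(\<Sum>j\<in>I. P i j * S j k) = (if i = k then 1 else 0) - P i r * S r k"
    unfolding sum.insert[OF I] by linarith
  moreover have "(\<Sum>j\<in>insert r I. P r j * S j k) = (if r = k then 1 else 0)"
    using inv ik unfolding inverse_on_def by blast
  then have *: "(\<Sum>j\<in>I. P r j * S j k) = - P r r * S r k"
    unfolding sum.insert[OF I] using ik I by (auto split: if_splits)
  have "(\<Sum>j\<in>I. P i r * P r j / P r r * S j k) = P i r / P r r * (- P r r * S r k)"
    unfolding *[symmetric] sum_distrib_left by (simp add: mult.assoc)
  ultimately show "(\<Sum>j\<in>I. schur r P i j * S j k) = (if i = k then 1 else 0)"
    using nz by (simp add: schur_def left_diff_distrib sum_subtractf)
qed

lemma inverse_on_pair:
  assumes inv: "inverse_on {k, i} P S" and P: "pos_def_on {k, i} P" and S: "pos_def_on {k, i} S"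
    and ne: "k \<noteq> i"
  shows "P i k = 0 \<longleftrightarrow> S k i = 0"
proof -
  have "(\<Sum>l\<in>{k, i}. P i l * S l k) = (if i = k then 1 else 0)"
    using inv unfolding inverse_on_def by blast
  then have "P i k * S k k + P i i * S i k = 0"
    using ne by simp
  moreover have "0 < S k k" "0 < P i i"
    using pos_def_on_diag[OF S, of k] pos_def_on_diag[OF P, of i] by auto
  moreover have "S i k = S k i" using pos_def_on_sym[OF S, of i k] by simp
  ultimately show ?thesis by auto
qed

text \<open>Cramer's rule by hand. The entries \<open>(j, k)\<close> and \<open>(j, i)\<close> of
  \<open>P S = 1\<close> are two linear equations for row \<open>j\<close> of \<open>P\<close>;
  eliminating \<open>P j k\<close> leaves \<open>P j i\<close> times a positive 2x2 minor on one
  side and \<open>P j j\<close> times the expression in question on the other.\<close>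

lemma inverse_on_triple:
  assumes inv: "inverse_on {k, i, j} P S" and P: "pos_def_on {k, i, j} P"
    and S: "pos_def_on {k, i, j} S" and ne: "k \<noteq> i" "k \<noteq> j" "i \<noteq> j"
  shows "P j i = 0 \<longleftrightarrow> S i j * S k k = S i k * S j k"
proof -
  have "(\<Sum>l\<in>{k, i, j}. P j l * S l k) = (if j = k then 1 else 0)"
    using inv unfolding inverse_on_def by blast
  then have k: "P j k * S k k + P j i * S i k + P j j * S j k = 0"
    using ne by simp
  have "(\<Sum>l\<in>{k, i, j}. P j l * S l i) = (if j = i then 1 else 0)"
    using inv unfolding inverse_on_def by blast
  then have i: "P j k * S k i + P j i * S i i + P j j * S j i = 0"
    using ne by simp
  have sym: "S k i = S i k" "S j i = S i j"
    using pos_def_on_sym[OF S, of k i] pos_def_on_sym[OF S, of j i] by auto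
  have pos: "0 < P j j" using pos_def_on_diag[OF P, of j] by simp
  have "(S i k)\<^sup>2 < S i i * S k k" using pos_def_on_minor[OF S, of i k] ne by simp
  moreover have "P j i * (S i i * S k k - (S i k)\<^sup>2) = P j j * (S i k * S j k - S i j * S k k)"
  proof -
    have "S k k * (P j k * S i k + P j i * S i i + P j j * S i j) -
        S i k * (P j k * S k k + P j i * S i k + P j j * S j k) = 0"
      using k i unfolding sym by simp
    then show ?thesis by (simp add: algebra_simps power2_eq_square)
  qed
  ultimately show ?thesis using pos
    by (metis diff_gt_0_iff_gt less_irrefl mult_eq_0_iff right_minus_eq)
qed

section \<open>Independence and conditional independence\<close>

lemma distributed_nn_integralI:
  assumes [measurable]: "X \<in> M \<rightarrow>\<^sub>M N" "f \<in> borel_measurable N"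
    and eq: "\<And>A. A \<in> sets N \<Longrightarrow> (\<integral>\<^sup>+\<omega>. indicator A (X \<omega>) \<partial>M) = (\<integral>\<^sup>+x. f x * indicator A x \<partial>N)"
  shows "distributed M N X f"
  unfolding distributed_def
proof (intro conjI measure_eqI)
  fix A assume "A \<in> sets (distr M N X)"
  then have [measurable]: "A \<in> sets N" by simp
  have "emeasure (distr M N X) A = (\<integral>\<^sup>+x. indicator A x \<partial>distr M N X)"
    by simp
  also have "\<dots> = (\<integral>\<^sup>+\<omega>. indicator A (X \<omega>) \<partial>M)"
    by (rule nn_integral_distr) measurable
  finally show "emeasure (distr M N X) A = emeasure (density N f) A"
    by (simp add: eq emeasure_density)
qed auto

lemma sigma_sets_vimage_generator:
  assumes f: "f \<in> M \<rightarrow>\<^sub>M N" and N: "sets N = sigma_sets (space N) E"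
  shows "sigma_sets (space M) {f -` A \<inter> space M |A. A \<in> sets N} =
    sigma_sets (space M) {f -` A \<inter> space M |A. A \<in> E}"
proof -
  have "f \<in> space M \<rightarrow> space N" using measurable_space[OF f] by blast
  then have *: "{f -` A \<inter> space M |A. A \<in> sets N} = sigma_sets (space M) {f -` A \<inter> space M |A. A \<in> E}"
    unfolding N by (rule sigma_sets_vimage_commute)
  show ?thesis unfolding * by (rule sigma_sets_sigma_sets_eq) auto
qed

lemma Int_stable_vimage:
  assumes "Int_stable E"
  shows "Int_stable {f -` A \<inter> \<Omega> |A. A \<in> E}"
proof (rule Int_stableI)
  fix a b assume "a \<in> {f -` A \<inter> \<Omega> |A. A \<in> E}" "b \<in> {f -` A \<inter> \<Omega> |A. A \<in> E}"
  then obtain A B where AB: "A \<in> E" "B \<in> E" "a = f -` A \<inter> \<Omega>" "b = f -` B \<inter> \<Omega>" by blast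
  then have "a \<inter> b = f -` (A \<inter> B) \<inter> \<Omega>" by auto
  moreover have "A \<inter> B \<in> E" using assms AB by (auto simp: Int_stable_def)
  ultimately show "a \<inter> b \<in> {f -` A \<inter> \<Omega> |A. A \<in> E}" by blast
qed

text \<open>Preimages of intersection-stable generators are again intersection-stable and generate
  the two sigma-algebras of preimages, so independence extends from the generators.\<close>

lemma (in prob_space) indep_var_generatorI:
  assumes X [measurable]: "X \<in> M \<rightarrow>\<^sub>M S" and Y [measurable]: "Y \<in> M \<rightarrow>\<^sub>M T"
    and S: "sets S = sigma_sets (space S) E" "Int_stable E"
    and T: "sets T = sigma_sets (space T) F" "Int_stable F"
    and eq: "\<And>A B. A \<in> E \<Longrightarrow> B \<in> F \<Longrightarrow>
      prob ((X -` A \<inter> space M) \<inter> (Y -` B \<inter> space M)) = prob (X -` A \<inter> space M) * prob (Y -` B \<inter> space M)"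
  shows "indep_var S X T Y"
proof -
  have "indep_set {X -` A \<inter> space M |A. A \<in> E} {Y -` A \<inter> space M |A. A \<in> F}"
  proof (rule indep_setI)
    have "A \<in> sets S" if "A \<in> E" for A using S(1) that by auto
    then show "{X -` A \<inter> space M |A. A \<in> E} \<subseteq> events" using X by (auto intro: measurable_sets)
    have "A \<in> sets T" if "A \<in> F" for A using T(1) that by auto
    then show "{Y -` A \<inter> space M |A. A \<in> F} \<subseteq> events" using Y by (auto intro: measurable_sets)
  qed (use eq in auto)
  then have "indep_set (sigma_sets (space M) {X -` A \<inter> space M |A. A \<in> E})
      (sigma_sets (space M) {Y -` A \<inter> space M |A. A \<in> F})"
    by (rule indep_set_sigma_sets) (rule Int_stable_vimage, fact)+
  then show ?thesis
    unfolding indep_var_eq sigma_sets_vimage_generator[OF X S(1)] sigma_sets_vimage_generator[OF Y T(1)]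
    using X Y by blast
qed

text \<open>The library's \<open>indep_var\<close> forces both variables to take values in the same type.\<close>

definition (in prob_space) indep_rv ::
  "'b measure \<Rightarrow> ('a \<Rightarrow> 'b) \<Rightarrow> 'c measure \<Rightarrow> ('a \<Rightarrow> 'c) \<Rightarrow> bool" where
  "indep_rv S X T Y \<longleftrightarrow> X \<in> M \<rightarrow>\<^sub>M S \<and> Y \<in> M \<rightarrow>\<^sub>M T \<and>
     distr M S X \<Otimes>\<^sub>M distr M T Y = distr M (S \<Otimes>\<^sub>M T) (\<lambda>\<omega>. (X \<omega>, Y \<omega>))"

lemma (in prob_space) indep_var_iff_indep_rv: "indep_var S X T Y \<longleftrightarrow> indep_rv S X T Y"
  by (simp add: indep_var_distribution_eq indep_rv_def)

lemma (in prob_space) indep_rv_nn_integralI: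
  assumes X [measurable]: "X \<in> M \<rightarrow>\<^sub>M S" and Y [measurable]: "Y \<in> M \<rightarrow>\<^sub>M T"
    and eq: "\<And>A B. A \<in> sets S \<Longrightarrow> B \<in> sets T \<Longrightarrow>
      (\<integral>\<^sup>+\<omega>. indicator A (X \<omega>) * indicator B (Y \<omega>) \<partial>M) =
      (\<integral>\<^sup>+\<omega>. indicator A (X \<omega>) \<partial>M) * (\<integral>\<^sup>+\<omega>. indicator B (Y \<omega>) \<partial>M)"
  shows "indep_rv S X T Y"
proof -
  interpret X: prob_space "distr M S X" by (rule prob_space_distr) fact
  interpret Y: prob_space "distr M T Y" by (rule prob_space_distr) fact
  have "distr M S X \<Otimes>\<^sub>M distr M T Y = distr M (S \<Otimes>\<^sub>M T) (\<lambda>\<omega>. (X \<omega>, Y \<omega>))"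
  proof (rule pair_measure_eqI)
    fix A B assume "A \<in> sets (distr M S X)" "B \<in> sets (distr M T Y)"
    then have [measurable]: "A \<in> sets S" "B \<in> sets T" by auto
    have "emeasure (distr M (S \<Otimes>\<^sub>M T) (\<lambda>\<omega>. (X \<omega>, Y \<omega>))) (A \<times> B) =
        (\<integral>\<^sup>+z. indicator (A \<times> B) z \<partial>distr M (S \<Otimes>\<^sub>M T) (\<lambda>\<omega>. (X \<omega>, Y \<omega>)))"
      by (rule nn_integral_indicator[symmetric]) simp
    also have "\<dots> = (\<integral>\<^sup>+\<omega>. indicator A (X \<omega>) * indicator B (Y \<omega>) \<partial>M)"
      by (subst nn_integral_distr) (auto simp: indicator_times)
    also have "\<dots> = (\<integral>\<^sup>+\<omega>. indicator A (X \<omega>) \<partial>M) * (\<integral>\<^sup>+\<omega>. indicator B (Y \<omega>) \<partial>M)"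
      by (rule eq) measurable
    also have "(\<integral>\<^sup>+\<omega>. indicator A (X \<omega>) \<partial>M) = (\<integral>\<^sup>+x. indicator A x \<partial>distr M S X)"
      by (rule nn_integral_distr[symmetric]) measurable
    also have "(\<integral>\<^sup>+\<omega>. indicator B (Y \<omega>) \<partial>M) = (\<integral>\<^sup>+y. indicator B y \<partial>distr M T Y)"
      by (rule nn_integral_distr[symmetric]) measurable
    finally show "emeasure (distr M S X) A * emeasure (distr M T Y) B =
        emeasure (distr M (S \<Otimes>\<^sub>M T) (\<lambda>\<omega>. (X \<omega>, Y \<omega>))) (A \<times> B)"
      by simp
  qed (auto intro: X.sigma_finite_measure_axioms Y.sigma_finite_measure_axioms)
  then show ?thesis using X Y by (simp add: indep_rv_def)
qed

lemma (in prob_space) indep_rv_nn_integral: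
  assumes ind: "indep_rv S X T Y" and F [measurable]: "F \<in> borel_measurable (S \<Otimes>\<^sub>M T)"
  shows "(\<integral>\<^sup>+\<omega>. F (X \<omega>, Y \<omega>) \<partial>M) = (\<integral>\<^sup>+\<omega>'. (\<integral>\<^sup>+\<omega>. F (X \<omega>, Y \<omega>') \<partial>M) \<partial>M)"
proof -
  have X [measurable]: "X \<in> M \<rightarrow>\<^sub>M S" and Y [measurable]: "Y \<in> M \<rightarrow>\<^sub>M T"
    and eq: "distr M (S \<Otimes>\<^sub>M T) (\<lambda>\<omega>. (X \<omega>, Y \<omega>)) = distr M S X \<Otimes>\<^sub>M distr M T Y"
    using ind by (auto simp: indep_rv_def)
  interpret X: prob_space "distr M S X" by (rule prob_space_distr) fact
  interpret Y: prob_space "distr M T Y" by (rule prob_space_distr) fact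
  interpret pair_sigma_finite "distr M S X" "distr M T Y" ..
  have F': "F \<in> borel_measurable (distr M S X \<Otimes>\<^sub>M distr M T Y)"
    using F by (simp cong: measurable_cong_sets)
  have "(\<integral>\<^sup>+\<omega>. F (X \<omega>, Y \<omega>) \<partial>M) = (\<integral>\<^sup>+z. F z \<partial>distr M (S \<Otimes>\<^sub>M T) (\<lambda>\<omega>. (X \<omega>, Y \<omega>)))"
    by (rule nn_integral_distr[symmetric]) measurable
  also have "\<dots> = (\<integral>\<^sup>+y. (\<integral>\<^sup>+x. F (x, y) \<partial>distr M S X) \<partial>distr M T Y)"
    unfolding eq by (rule nn_integral_snd[OF F', symmetric])
  also have "\<dots> = (\<integral>\<^sup>+y. (\<integral>\<^sup>+\<omega>. F (X \<omega>, y) \<partial>M) \<partial>distr M T Y)"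
    by (intro nn_integral_cong nn_integral_distr) auto
  also have "\<dots> = (\<integral>\<^sup>+\<omega>'. (\<integral>\<^sup>+\<omega>. F (X \<omega>, Y \<omega>') \<partial>M) \<partial>M)"
    by (rule nn_integral_distr) measurable
  finally show ?thesis .
qed

lemma (in prob_space) indep_rv_mult:
  assumes ind: "indep_rv S X T Y"
    and F [measurable]: "F \<in> borel_measurable S" and G [measurable]: "G \<in> borel_measurable T"
  shows "(\<integral>\<^sup>+\<omega>. F (X \<omega>) * G (Y \<omega>) \<partial>M) = (\<integral>\<^sup>+\<omega>. F (X \<omega>) \<partial>M) * (\<integral>\<^sup>+\<omega>. G (Y \<omega>) \<partial>M)"
proof -
  have [measurable]: "X \<in> M \<rightarrow>\<^sub>M S" "Y \<in> M \<rightarrow>\<^sub>M T" using ind by (auto simp: indep_rv_def)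
  have "(\<integral>\<^sup>+\<omega>. F (X \<omega>) * G (Y \<omega>) \<partial>M) = (\<integral>\<^sup>+\<omega>'. (\<integral>\<^sup>+\<omega>. F (X \<omega>) * G (Y \<omega>') \<partial>M) \<partial>M)"
    using indep_rv_nn_integral[OF ind, of "\<lambda>(x, y). F x * G y"] by simp
  also have "\<dots> = (\<integral>\<^sup>+\<omega>'. (\<integral>\<^sup>+\<omega>. F (X \<omega>) \<partial>M) * G (Y \<omega>') \<partial>M)"
    by (intro nn_integral_cong nn_integral_multc) measurable
  also have "\<dots> = (\<integral>\<^sup>+\<omega>. F (X \<omega>) \<partial>M) * (\<integral>\<^sup>+\<omega>. G (Y \<omega>) \<partial>M)"
    by (rule nn_integral_cmult) measurable
  finally show ?thesis .
qed

lemma (in prob_space) indep_rv_compose: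
  assumes ind: "indep_rv S X T Y" and f [measurable]: "f \<in> S \<rightarrow>\<^sub>M S'" and g [measurable]: "g \<in> T \<rightarrow>\<^sub>M T'"
  shows "indep_rv S' (\<lambda>\<omega>. f (X \<omega>)) T' (\<lambda>\<omega>. g (Y \<omega>))"
proof (rule indep_rv_nn_integralI)
  have [measurable]: "X \<in> M \<rightarrow>\<^sub>M S" "Y \<in> M \<rightarrow>\<^sub>M T" using ind by (auto simp: indep_rv_def)
  show "(\<lambda>\<omega>. f (X \<omega>)) \<in> M \<rightarrow>\<^sub>M S'" "(\<lambda>\<omega>. g (Y \<omega>)) \<in> M \<rightarrow>\<^sub>M T'" by measurable
  fix A B assume [measurable]: "A \<in> sets S'" "B \<in> sets T'"
  show "(\<integral>\<^sup>+\<omega>. indicator A (f (X \<omega>)) * indicator B (g (Y \<omega>)) \<partial>M) =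
      (\<integral>\<^sup>+\<omega>. indicator A (f (X \<omega>)) \<partial>M) * (\<integral>\<^sup>+\<omega>. indicator B (g (Y \<omega>)) \<partial>M)"
    by (rule indep_rv_mult[OF ind, of "\<lambda>x. indicator A (f x)" "\<lambda>y. indicator B (g y)"]) measurable
qed

text \<open>Regroups three successively independent variables. The variable \<open>Z\<close> is
  integrated last; for each frozen value of \<open>Z\<close>, the independence of \<open>X\<close>
  and \<open>Y\<close> splits off the factor belonging to \<open>X\<close>, which does not depend on
  \<open>Z\<close>.\<close>

lemma (in prob_space) indep_rv_Pair:
  assumes XY: "indep_rv S X T Y" and XYZ: "indep_rv (S \<Otimes>\<^sub>M T) (\<lambda>\<omega>. (X \<omega>, Y \<omega>)) R Z"
  shows "indep_rv (T \<Otimes>\<^sub>M R) (\<lambda>\<omega>. (Y \<omega>, Z \<omega>)) S X"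
proof (rule indep_rv_nn_integralI)
  have [measurable]: "X \<in> M \<rightarrow>\<^sub>M S" "Y \<in> M \<rightarrow>\<^sub>M T" "Z \<in> M \<rightarrow>\<^sub>M R"
    using assms by (auto simp: indep_rv_def)
  then show "(\<lambda>\<omega>. (Y \<omega>, Z \<omega>)) \<in> M \<rightarrow>\<^sub>M T \<Otimes>\<^sub>M R" "X \<in> M \<rightarrow>\<^sub>M S" by measurable
  fix A B assume A [measurable]: "A \<in> sets (T \<Otimes>\<^sub>M R)" and B [measurable]: "B \<in> sets S"
  have "indep_rv T Y R Z"
    using indep_rv_compose[OF XYZ, of snd T "\<lambda>z. z" R] by simp
  from indep_rv_nn_integral[OF this, of "indicator A"]
  have YZ: "(\<integral>\<^sup>+\<omega>. indicator A (Y \<omega>, Z \<omega>) \<partial>M) = (\<integral>\<^sup>+\<omega>'. (\<integral>\<^sup>+\<omega>. indicator A (Y \<omega>, Z \<omega>') \<partial>M) \<partial>M)"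
    by simp
  have "(\<integral>\<^sup>+\<omega>. indicator A (Y \<omega>, Z \<omega>) * indicator B (X \<omega>) \<partial>M) =
      (\<integral>\<^sup>+\<omega>'. (\<integral>\<^sup>+\<omega>. indicator A (Y \<omega>, Z \<omega>') * indicator B (X \<omega>) \<partial>M) \<partial>M)"
    by (rule indep_rv_nn_integral[OF XYZ, of "\<lambda>w. indicator A (snd (fst w), snd w) * indicator B (fst (fst w))",
          unfolded fst_conv snd_conv]) measurable
  also have "\<dots> = (\<integral>\<^sup>+\<omega>'. (\<integral>\<^sup>+\<omega>. indicator B (X \<omega>) \<partial>M) * (\<integral>\<^sup>+\<omega>. indicator A (Y \<omega>, Z \<omega>') \<partial>M) \<partial>M)"
  proof (rule nn_integral_cong)
    fix \<omega>' assume "\<omega>' \<in> space M"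
    then have [measurable]: "Z \<omega>' \<in> space R" using measurable_space[of Z M R] by auto
    show "(\<integral>\<^sup>+\<omega>. indicator A (Y \<omega>, Z \<omega>') * indicator B (X \<omega>) \<partial>M) =
        (\<integral>\<^sup>+\<omega>. indicator B (X \<omega>) \<partial>M) * (\<integral>\<^sup>+\<omega>. indicator A (Y \<omega>, Z \<omega>') \<partial>M)"
      using indep_rv_mult[OF XY, of "indicator B" "\<lambda>y. indicator A (y, Z \<omega>')"] by (simp add: mult.commute)
  qed
  also have "\<dots> = (\<integral>\<^sup>+\<omega>. indicator B (X \<omega>) \<partial>M) * (\<integral>\<^sup>+\<omega>'. (\<integral>\<^sup>+\<omega>. indicator A (Y \<omega>, Z \<omega>') \<partial>M) \<partial>M)"
    by (rule nn_integral_cmult) measurable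
  finally show "(\<integral>\<^sup>+\<omega>. indicator A (Y \<omega>, Z \<omega>) * indicator B (X \<omega>) \<partial>M) =
      (\<integral>\<^sup>+\<omega>. indicator A (Y \<omega>, Z \<omega>) \<partial>M) * (\<integral>\<^sup>+\<omega>. indicator B (X \<omega>) \<partial>M)"
    by (simp add: YZ mult.commute)
qed

section \<open>Conditional expectation given an independent variable\<close>

lemma (in prob_space) indep_rv_integral:
  fixes g :: "'b \<times> 'c \<Rightarrow> real"
  assumes ind: "indep_rv S X T Y" and g [measurable]: "g \<in> borel_measurable (S \<Otimes>\<^sub>M T)"
    and bnd: "\<And>z. \<bar>g z\<bar> \<le> B"
  shows "(\<integral>\<omega>. g (X \<omega>, Y \<omega>) \<partial>M) = (\<integral>\<omega>'. (\<integral>\<omega>. g (X \<omega>, Y \<omega>') \<partial>M) \<partial>M)"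
proof -
  have X [measurable]: "X \<in> M \<rightarrow>\<^sub>M S" and Y [measurable]: "Y \<in> M \<rightarrow>\<^sub>M T"
    and eq: "distr M (S \<Otimes>\<^sub>M T) (\<lambda>\<omega>. (X \<omega>, Y \<omega>)) = distr M S X \<Otimes>\<^sub>M distr M T Y"
    using ind by (auto simp: indep_rv_def)
  interpret X: prob_space "distr M S X" by (rule prob_space_distr) fact
  interpret Y: prob_space "distr M T Y" by (rule prob_space_distr) fact
  interpret XY: pair_prob_space "distr M S X" "distr M T Y" ..
  have g' [measurable]: "g \<in> borel_measurable (distr M S X \<Otimes>\<^sub>M distr M T Y)"
    using g by (simp cong: measurable_cong_sets)
  have int: "integrable (distr M S X \<Otimes>\<^sub>M distr M T Y) (case_prod (\<lambda>x y. g (x, y)))"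
    using bnd by (intro XY.P.integrable_const_bound[of _ B]) auto
  have gX: "g \<in> borel_measurable (distr M S X \<Otimes>\<^sub>M T)"
    using g by (simp cong: measurable_cong_sets)
  have "(\<integral>\<omega>. g (X \<omega>, Y \<omega>) \<partial>M) = (\<integral>z. g z \<partial>distr M (S \<Otimes>\<^sub>M T) (\<lambda>\<omega>. (X \<omega>, Y \<omega>)))"
    by (rule integral_distr[symmetric]) measurable
  also have "\<dots> = (\<integral>y. (\<integral>x. g (x, y) \<partial>distr M S X) \<partial>distr M T Y)"
    unfolding eq using XY.integral_snd[OF int] by simp
  also have "\<dots> = (\<integral>\<omega>'. (\<integral>x. g (x, Y \<omega>') \<partial>distr M S X) \<partial>M)"
    by (rule integral_distr) (use gX in measurable)
  also have "\<dots> = (\<integral>\<omega>'. (\<integral>\<omega>. g (X \<omega>, Y \<omega>') \<partial>M) \<partial>M)"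
  proof (rule Bochner_Integration.integral_cong[OF refl])
    fix \<omega>' assume "\<omega>' \<in> space M"
    then have [measurable]: "Y \<omega>' \<in> space T" using measurable_space[OF Y] by auto
    show "(\<integral>x. g (x, Y \<omega>') \<partial>distr M S X) = (\<integral>\<omega>. g (X \<omega>, Y \<omega>') \<partial>M)"
      by (rule integral_distr) measurable
  qed
  finally show ?thesis .
qed

text \<open>The freezing rule: given \<open>Y\<close>, its value is held fixed and \<open>X\<close>
  is averaged out. A set of the conditioning sigma-algebra is a preimage under \<open>Y\<close>, so
  its indicator is a function of \<open>Y\<close>, and Fubini verifies the defining property of the
  conditional expectation.\<close>

lemma (in prob_space) real_cond_exp_indep_rv:
  fixes g :: "'b \<times> 'c \<Rightarrow> real"
  assumes ind: "indep_rv S X T Y" and g [measurable]: "g \<in> borel_measurable (S \<Otimes>\<^sub>M T)"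
    and bnd: "\<And>z. \<bar>g z\<bar> \<le> B"
  shows "AE \<omega> in M. real_cond_exp M (vimage_algebra (space M) Y T) (\<lambda>\<omega>. g (X \<omega>, Y \<omega>)) \<omega> =
    (\<integral>\<omega>'. g (X \<omega>', Y \<omega>) \<partial>M)"
proof -
  let ?F = "vimage_algebra (space M) Y T"
  define h where "h y = (\<integral>\<omega>'. g (X \<omega>', y) \<partial>M)" for y
  have X [measurable]: "X \<in> M \<rightarrow>\<^sub>M S" and Y [measurable]: "Y \<in> M \<rightarrow>\<^sub>M T"
    using ind by (auto simp: indep_rv_def)
  have h [measurable]: "h \<in> borel_measurable T"
    unfolding h_def by measurable
  have hbnd: "\<bar>h y\<bar> \<le> B" if [measurable]: "y \<in> space T" for y
  proof -
    have "\<bar>h y\<bar> \<le> (\<integral>\<omega>'. \<bar>g (X \<omega>', y)\<bar> \<partial>M)" unfolding h_def by (rule integral_abs_bound)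
    also have "\<dots> \<le> (\<integral>\<omega>'. B \<partial>M)"
      by (intro integral_mono integrable_const_bound[of _ B])
        (use bnd order_trans[OF abs_ge_zero bnd] in auto)
    finally show ?thesis by (simp add: prob_space)
  qed
  have Ysp: "Y \<in> space M \<rightarrow> space T" using measurable_space[OF Y] by blast
  have sub: "subalgebra M ?F"
    unfolding subalgebra_def sets_vimage_algebra2[OF Ysp] using Y by (auto intro: measurable_sets)
  interpret finite_measure_subalgebra M ?F by standard (rule sub)
  have YF: "Y \<in> ?F \<rightarrow>\<^sub>M T" by (rule measurable_vimage_algebra1[OF Ysp])
  have "AE \<omega> in M. real_cond_exp M ?F (\<lambda>\<omega>. g (X \<omega>, Y \<omega>)) \<omega> = h (Y \<omega>)"
  proof (rule real_cond_exp_charact)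
    show "integrable M (\<lambda>\<omega>. g (X \<omega>, Y \<omega>))"
      by (intro integrable_const_bound[of _ B]) (use bnd in auto)
    show "integrable M (\<lambda>\<omega>. h (Y \<omega>))"
      by (intro integrable_const_bound[of _ B]) (use hbnd measurable_space[OF Y] in auto)
    show "(\<lambda>\<omega>. h (Y \<omega>)) \<in> borel_measurable ?F"
      using measurable_compose[OF YF h] .
    fix A assume "A \<in> sets ?F"
    then obtain C where C [measurable]: "C \<in> sets T" and A: "A = Y -` C \<inter> space M"
      unfolding sets_vimage_algebra2[OF Ysp] by blast
    have A_ind: "indicator A \<omega> = (indicator C (Y \<omega>) :: real)" if "\<omega> \<in> space M" for \<omega>
      using that by (auto simp: A split: split_indicator)
    have "(\<integral>\<omega>\<in>A. g (X \<omega>, Y \<omega>) \<partial>M) = (\<integral>\<omega>. indicator C (Y \<omega>) * g (X \<omega>, Y \<omega>) \<partial>M)"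
      unfolding set_lebesgue_integral_def by (intro Bochner_Integration.integral_cong) (auto simp: A_ind)
    also have "\<dots> = (\<integral>\<omega>'. (\<integral>\<omega>. indicator C (Y \<omega>') * g (X \<omega>, Y \<omega>') \<partial>M) \<partial>M)"
    proof (rule indep_rv_integral[OF ind, of "\<lambda>z. indicator C (snd z) * g z" B, unfolded snd_conv])
      show "\<bar>indicator C (snd z) * g z\<bar> \<le> B" for z
        using bnd[of z] by (auto split: split_indicator)
    qed measurable
    also have "\<dots> = (\<integral>\<omega>'. indicator C (Y \<omega>') * h (Y \<omega>') \<partial>M)"
      by (simp add: h_def)
    also have "\<dots> = (\<integral>\<omega>\<in>A. h (Y \<omega>) \<partial>M)"
      unfolding set_lebesgue_integral_def by (intro Bochner_Integration.integral_cong) (auto simp: A_ind)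
    finally show "(\<integral>\<omega>\<in>A. g (X \<omega>, Y \<omega>) \<partial>M) = (\<integral>\<omega>\<in>A. h (Y \<omega>) \<partial>M)" .
  qed
  then show ?thesis by (simp add: h_def)
qed

section \<open>Testing independence on countably many half-lines\<close>

lemma borel_eq_atMost_rat:
  "(borel :: real measure) = sigma UNIV (range (\<lambda>q::rat. {..real_of_rat q}))"
proof (rule borel_eq_sigmaI1[OF borel_eq_atMost])
  fix x :: "real set" assume "x \<in> range (\<lambda>a. {..a})"
  then obtain a where x: "x = {..a}" by auto
  have "x = (\<Inter>q\<in>{q. a < real_of_rat q}. {..real_of_rat q})"
  proof
    show "(\<Inter>q\<in>{q. a < real_of_rat q}. {..real_of_rat q}) \<subseteq> x"
    proof
      fix y assume y: "y \<in> (\<Inter>q\<in>{q. a < real_of_rat q}. {..real_of_rat q})"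
      have "\<not> a < y"
      proof
        assume "a < y"
        then obtain q where "a < real_of_rat q" "real_of_rat q < y" using of_rat_dense by blast
        with y show False by auto
      qed
      then show "y \<in> x" by (simp add: x)
    qed
  qed (auto simp: x)
  also have "\<dots> \<in> sets (sigma UNIV (range (\<lambda>q::rat. {..real_of_rat q})))"
    by (rule sets.countable_INT'') (auto intro: sigma_sets_top)
  finally show "x \<in> sets (sigma UNIV (range (\<lambda>q::rat. {..real_of_rat q})))" .
qed auto

text \<open>The generator is countable, so its conditions can be extracted from almost sure ones.
  They are phrased with integrals of indicators because conditional expectations deliver them in
  that form.\<close>

lemma (in prob_space) indep_var_atMost_ratI:
  fixes X Y :: "'a \<Rightarrow> real"
  assumes [measurable]: "X \<in> borel_measurable M" "Y \<in> borel_measurable M"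
    and eq: "\<And>p q :: rat. (\<integral>\<omega>. indicator {..real_of_rat p} (X \<omega>) * indicator {..real_of_rat q} (Y \<omega>) \<partial>M) =
      (\<integral>\<omega>. indicator {..real_of_rat p} (X \<omega>) \<partial>M) * (\<integral>\<omega>. indicator {..real_of_rat q} (Y \<omega>) \<partial>M :: real)"
  shows "indep_var borel X borel Y"
proof -
  let ?E = "range (\<lambda>q::rat. {..real_of_rat q})"
  have gen: "sets (borel :: real measure) = sigma_sets (space borel) ?E"
    by (subst borel_eq_atMost_rat) simp
  have "{..real_of_rat p} \<inter> {..real_of_rat q} = {..real_of_rat (min p q)}" for p q
    by (auto simp: min_def of_rat_less_eq intro: order_trans)
  then have stable: "Int_stable ?E"
    by (auto simp: Int_stable_def)
  have ind: "(\<integral>\<omega>. indicator A (Z \<omega>) \<partial>M) = prob (Z -` A \<inter> space M)"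
    if [measurable]: "A \<in> sets borel" "Z \<in> borel_measurable M" for A and Z :: "'a \<Rightarrow> real"
  proof -
    have "(\<integral>\<omega>. indicator A (Z \<omega>) \<partial>M) = (\<integral>\<omega>. (indicator (Z -` A \<inter> space M) \<omega> :: real) \<partial>M)"
      by (intro Bochner_Integration.integral_cong) (auto split: split_indicator)
    then show ?thesis by simp
  qed
  show ?thesis
  proof (rule indep_var_generatorI[OF _ _ gen stable gen stable])
    fix A B assume AB: "A \<in> ?E" "B \<in> ?E"
    then have [measurable]: "A \<in> sets borel" "B \<in> sets borel" by auto
    have "prob ((X -` A \<inter> space M) \<inter> (Y -` B \<inter> space M)) =
        (\<integral>\<omega>. indicator ((X -` A \<inter> space M) \<inter> (Y -` B \<inter> space M)) \<omega> \<partial>M)"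
      by simp
    also have "\<dots> = (\<integral>\<omega>. indicator A (X \<omega>) * indicator B (Y \<omega>) \<partial>M)"
      by (intro Bochner_Integration.integral_cong) (auto split: split_indicator)
    also have "\<dots> = prob (X -` A \<inter> space M) * prob (Y -` B \<inter> space M)"
      using AB eq by (auto simp flip: ind)
    finally show "prob ((X -` A \<inter> space M) \<inter> (Y -` B \<inter> space M)) =
      prob (X -` A \<inter> space M) * prob (Y -` B \<inter> space M)" .
  qed measurable
qed

lemma (in prob_space) indep_var_shift:
  fixes X Y :: "'a \<Rightarrow> real"
  shows "indep_var borel (\<lambda>\<omega>. X \<omega> + a) borel (\<lambda>\<omega>. Y \<omega> + b) \<longleftrightarrow> indep_var borel X borel Y"
proof
  assume "indep_var borel X borel Y"
  from indep_var_compose[OF this, of "\<lambda>x. x + a" borel "\<lambda>x. x + b" borel]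
  show "indep_var borel (\<lambda>\<omega>. X \<omega> + a) borel (\<lambda>\<omega>. Y \<omega> + b)" by (simp add: comp_def)
next
  assume "indep_var borel (\<lambda>\<omega>. X \<omega> + a) borel (\<lambda>\<omega>. Y \<omega> + b)"
  from indep_var_compose[OF this, of "\<lambda>x. x - a" borel "\<lambda>x. x - b" borel]
  show "indep_var borel X borel Y" by (simp add: comp_def)
qed

text \<open>By the freezing rule the conditional probabilities at \<open>Z = z\<close> are plain
  probabilities for \<open>U + a * z\<close> and \<open>V + b * z\<close>. Conditional independence
  thus says that these shifted variables satisfy the product formulas for almost every
  \<open>z\<close>, and shifts do not affect independence.\<close>

lemma (in prob_space) cond_indep_var_iff_indep_residuals:
  fixes U V X Y Z :: "'a \<Rightarrow> real"
  assumes ind: "indep_rv (borel \<Otimes>\<^sub>M borel) (\<lambda>\<omega>. (U \<omega>, V \<omega>)) borel Z"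
    and X: "\<And>\<omega>. X \<omega> = U \<omega> + a * Z \<omega>" and Y: "\<And>\<omega>. Y \<omega> = V \<omega> + b * Z \<omega>"
  shows "cond_indep_var M X Y Z \<longleftrightarrow> indep_var borel U borel V"
proof -
  have Z [measurable]: "Z \<in> borel_measurable M"
    and UV: "(\<lambda>\<omega>. (U \<omega>, V \<omega>)) \<in> M \<rightarrow>\<^sub>M borel \<Otimes>\<^sub>M borel"
    using ind by (auto simp: indep_rv_def)
  have U [measurable]: "U \<in> borel_measurable M" and V [measurable]: "V \<in> borel_measurable M"
    using measurable_compose[OF UV measurable_fst] measurable_compose[OF UV measurable_snd] by auto
  have [measurable]: "X \<in> borel_measurable M" "Y \<in> borel_measurable M"
    unfolding X Y by measurable
  let ?F = "vimage_algebra (space M) Z borel"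
  let ?iA = "\<lambda>A z \<omega>. indicator A (U \<omega> + a * z) :: real"
  let ?iB = "\<lambda>B z \<omega>. indicator B (V \<omega> + b * z) :: real"
  have EXY: "AE \<omega> in M. real_cond_exp M ?F (\<lambda>\<omega>. indicator A (X \<omega>) * indicator B (Y \<omega>)) \<omega> =
      (\<integral>\<omega>'. ?iA A (Z \<omega>) \<omega>' * ?iB B (Z \<omega>) \<omega>' \<partial>M)"
    if [measurable]: "A \<in> sets borel" "B \<in> sets borel" for A B
    unfolding X Y
    by (rule real_cond_exp_indep_rv[OF ind, of "\<lambda>w :: (real \<times> real) \<times> real. indicator A (fst (fst w) + a * snd w) * indicator B (snd (fst w) + b * snd w)" 1,
          unfolded fst_conv snd_conv]) (measurable, auto split: split_indicator)
  have EX: "AE \<omega> in M. real_cond_exp M ?F (\<lambda>\<omega>. indicator A (X \<omega>)) \<omega> = (\<integral>\<omega>'. ?iA A (Z \<omega>) \<omega>' \<partial>M)"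
    if [measurable]: "A \<in> sets borel" for A
    unfolding X
    by (rule real_cond_exp_indep_rv[OF ind, of "\<lambda>w :: (real \<times> real) \<times> real. indicator A (fst (fst w) + a * snd w)" 1,
          unfolded fst_conv snd_conv]) (auto split: split_indicator)
  have EY: "AE \<omega> in M. real_cond_exp M ?F (\<lambda>\<omega>. indicator B (Y \<omega>)) \<omega> = (\<integral>\<omega>'. ?iB B (Z \<omega>) \<omega>' \<partial>M)"
    if [measurable]: "B \<in> sets borel" for B
    unfolding Y
    by (rule real_cond_exp_indep_rv[OF ind, of "\<lambda>w :: (real \<times> real) \<times> real. indicator B (snd (fst w) + b * snd w)" 1,
          unfolded fst_conv snd_conv]) (auto split: split_indicator)
  show ?thesis
  proof
    assume UV: "indep_var borel U borel V"
    show "cond_indep_var M X Y Z"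
      unfolding cond_indep_var_def Let_def
    proof (intro conjI ballI)
      fix A B :: "real set" assume AB [measurable]: "A \<in> sets borel" "B \<in> sets borel"
      have mult: "(\<integral>\<omega>'. ?iA A z \<omega>' * ?iB B z \<omega>' \<partial>M) = (\<integral>\<omega>'. ?iA A z \<omega>' \<partial>M) * (\<integral>\<omega>'. ?iB B z \<omega>' \<partial>M)" for z
      proof (rule indep_var_lebesgue_integral)
        show "indep_var borel (?iA A z) borel (?iB B z)"
          using indep_var_compose[OF UV, of "\<lambda>u. indicator A (u + a * z)" borel "\<lambda>v. indicator B (v + b * z)" borel]
          by (simp add: comp_def)
        show "integrable M (?iA A z)" "integrable M (?iB B z)"
          by (intro integrable_const_bound[of _ 1]; simp)+
      qed
      from EXY[OF AB] EX[OF AB(1)] EY[OF AB(2)]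
      show "AE \<omega> in M. real_cond_exp M ?F (\<lambda>\<omega>. indicator A (X \<omega>) * indicator B (Y \<omega>)) \<omega> =
          real_cond_exp M ?F (\<lambda>\<omega>. indicator A (X \<omega>)) \<omega> * real_cond_exp M ?F (\<lambda>\<omega>. indicator B (Y \<omega>)) \<omega>"
        by eventually_elim (simp add: mult)
    qed measurable
  next
    assume ci: "cond_indep_var M X Y Z"
    let ?H = "\<lambda>q::rat. {..real_of_rat q}"
    let ?P = "\<lambda>z p q. (\<integral>\<omega>'. ?iA (?H p) z \<omega>' * ?iB (?H q) z \<omega>' \<partial>M) =
      (\<integral>\<omega>'. ?iA (?H p) z \<omega>' \<partial>M) * (\<integral>\<omega>'. ?iB (?H q) z \<omega>' \<partial>M)"
    have "AE \<omega> in M. ?P (Z \<omega>) p q" for p q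
    proof -
      have H: "?H p \<in> sets borel" "?H q \<in> sets borel" by auto
      then have "AE \<omega> in M. real_cond_exp M ?F (\<lambda>\<omega>. indicator (?H p) (X \<omega>) * indicator (?H q) (Y \<omega>)) \<omega> =
          real_cond_exp M ?F (\<lambda>\<omega>. indicator (?H p) (X \<omega>)) \<omega> * real_cond_exp M ?F (\<lambda>\<omega>. indicator (?H q) (Y \<omega>)) \<omega>"
        using ci unfolding cond_indep_var_def Let_def by blast
      with EXY[OF H] EX[OF H(1)] EY[OF H(2)] show ?thesis by eventually_elim simp
    qed
    \<comment> \<open>The pairs of rationals are countable, so their exceptional null sets can be
      merged into one.\<close>
    then have ae: "AE \<omega> in M. \<forall>p q. ?P (Z \<omega>) p q" unfolding AE_all_countable by blast
    \<comment> \<open>A property that holds almost surely on a probability space holds somewhere; a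
      single good value of \<open>Z\<close> is enough.\<close>
    have "\<exists>z. \<forall>p q. ?P z p q"
    proof (rule ccontr)
      assume no: "\<nexists>z. \<forall>p q. ?P z p q"
      from ae have "AE \<omega> in M. False"
        by eventually_elim (use no in blast)
      then show False by (simp only: AE_False)
    qed
    then obtain z where "\<And>p q. ?P z p q" by blast
    then have "indep_var borel (\<lambda>\<omega>. U \<omega> + a * z) borel (\<lambda>\<omega>. V \<omega> + b * z)"
      by (intro indep_var_atMost_ratI) auto
    then show "indep_var borel U borel V" by (simp only: indep_var_shift)
  qed
qed

section \<open>Gaussian families\<close>

definition gauss :: "'i set \<Rightarrow> ('i \<Rightarrow> 'i \<Rightarrow> real) \<Rightarrow> ('i \<Rightarrow> real) \<Rightarrow> ('i \<Rightarrow> real) \<Rightarrow> ennreal" where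
  "gauss I P m x = ennreal (exp (- quad I P (\<lambda>i. x i - m i) / 2))"

lemma gauss_measurable [measurable]:
  assumes "I \<subseteq> J"
  shows "gauss I P m \<in> borel_measurable (Pi\<^sub>M J (\<lambda>_. lborel))"
proof -
  have [measurable]: "(\<lambda>x. x i) \<in> borel_measurable (Pi\<^sub>M J (\<lambda>_. lborel))" if "i \<in> I" for i
    using measurable_component_singleton[of i J "\<lambda>_. lborel :: real measure"] that assms by auto
  show ?thesis unfolding gauss_def quad_def by measurable
qed

text \<open>Integrating over \<open>x r\<close> first, the completed square is a translate of a
  one-dimensional Gaussian, and translation invariance of Lebesgue measure removes its dependence on
  the other coordinates. The arbitrary factors \<open>F\<close> and \<open>G\<close> make this one
  formula serve for the marginal law, the law of the residual and their independence.\<close>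

lemma nn_integral_gauss_insert:
  fixes m :: "'i \<Rightarrow> real"
  assumes I: "finite I" "r \<notin> I" and P: "pos_def_on (insert r I) P"
    and F: "F \<in> borel_measurable (Pi\<^sub>M I (\<lambda>_. lborel))" and G: "G \<in> borel_measurable borel"
  shows "(\<integral>\<^sup>+x. F (restrict x I) * G (x r - m r + (\<Sum>i\<in>I. P r i / P r r * (x i - m i))) *
      gauss (insert r I) P m x \<partial>Pi\<^sub>M (insert r I) (\<lambda>_. lborel)) =
    (\<integral>\<^sup>+x. F x * gauss I (schur r P) m x \<partial>Pi\<^sub>M I (\<lambda>_. lborel)) *
    (\<integral>\<^sup>+t. G t * ennreal (exp (- (P r r * t\<^sup>2) / 2)) \<partial>lborel)"
proof -
  interpret product_sigma_finite "\<lambda>_::'i. lborel :: real measure" ..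
  have pos: "0 < P r r" using pos_def_on_diag[OF P] I by auto
  have sym: "P i r = P r i" if "i \<in> I" for i using pos_def_on_sym[OF P] that by blast
  \<comment> \<open>The residual is \<open>x r + s x\<close>, where \<open>s x\<close> depends only
    on the coordinates in \<open>I\<close>; for fixed ones it is a translation.\<close>
  define s where "s x = (\<Sum>i\<in>I. P r i / P r r * (x i - m i)) - m r" for x :: "'i \<Rightarrow> real"
  note F [measurable] G [measurable]
  \<comment> \<open>The shape \<open>c + 1 * t\<close> is that of the affine substitution rule with
    slope 1, which is applied below.\<close>
  have G': "(\<lambda>t. G (c + 1 * t) * ennreal (exp (- (P r r * (c + 1 * t)\<^sup>2) / 2))) \<in> borel_measurable lborel"
    and G'': "(\<lambda>t. G t * ennreal (exp (- (P r r * t\<^sup>2) / 2))) \<in> borel_measurable borel" for c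
    by measurable
  have [measurable]: "(\<lambda>x. x i) \<in> borel_measurable (Pi\<^sub>M (insert r I) (\<lambda>_. lborel))" if "i \<in> insert r I" for i
    using measurable_component_singleton[of i "insert r I" "\<lambda>_. lborel :: real measure"] that by auto
  have [measurable]: "(\<lambda>x. restrict x I) \<in> Pi\<^sub>M (insert r I) (\<lambda>_. lborel) \<rightarrow>\<^sub>M Pi\<^sub>M I (\<lambda>_. lborel :: real measure)"
    by (rule measurable_restrict_subset) auto
  have [measurable]: "s \<in> borel_measurable (Pi\<^sub>M (insert r I) (\<lambda>_. lborel))"
    unfolding s_def by measurable
  have [measurable]: "gauss J Q m \<in> borel_measurable (Pi\<^sub>M J (\<lambda>_. lborel))" for J Q
    by (rule gauss_measurable) simp
  have "(\<integral>\<^sup>+x. F (restrict x I) * G (x r + s x) * gauss (insert r I) P m x \<partial>Pi\<^sub>M (insert r I) (\<lambda>_. lborel)) =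
    (\<integral>\<^sup>+x. (\<integral>\<^sup>+t. F (restrict (x(r := t)) I) * G ((x(r := t)) r + s (x(r := t))) *
       gauss (insert r I) P m (x(r := t)) \<partial>lborel) \<partial>Pi\<^sub>M I (\<lambda>_. lborel))"
    by (rule product_nn_integral_insert[OF I]) measurable
  also have "\<dots> = (\<integral>\<^sup>+x. F x * gauss I (schur r P) m x *
      (\<integral>\<^sup>+t. G t * ennreal (exp (- (P r r * t\<^sup>2) / 2)) \<partial>lborel) \<partial>Pi\<^sub>M I (\<lambda>_. lborel))"
  proof (rule nn_integral_cong)
    fix x assume x: "x \<in> space (Pi\<^sub>M I (\<lambda>_. lborel :: real measure))"
    have upd: "(x(r := t)) i = x i" if "i \<in> I" for i t using that I by auto
    have 1: "restrict (x(r := t)) I = x" for t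
      using x I by (auto simp: space_PiM restrict_def fun_eq_iff PiE_def extensional_def)
    have 2: "s (x(r := t)) = s x" for t
      unfolding s_def using upd by (simp cong: sum.cong)
    have 3: "gauss (insert r I) P m (x(r := t)) =
        gauss I (schur r P) m x * ennreal (exp (- (P r r * (t + s x)\<^sup>2) / 2))" for t
    proof -
      have "quad (insert r I) P (\<lambda>i. (x(r := t)) i - m i) =
        P r r * ((x(r := t)) r - m r + (\<Sum>i\<in>I. P r i / P r r * ((x(r := t)) i - m i)))\<^sup>2 +
        quad I (schur r P) (\<lambda>i. (x(r := t)) i - m i)"
        using pos by (intro quad_insert I) (auto simp: sym)
      also have "quad I (schur r P) (\<lambda>i. (x(r := t)) i - m i) = quad I (schur r P) (\<lambda>i. x i - m i)"
        by (rule quad_cong) (simp only: upd)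
      also have "(x(r := t)) r - m r + (\<Sum>i\<in>I. P r i / P r r * ((x(r := t)) i - m i)) = t + s x"
        unfolding s_def using upd by (simp cong: sum.cong)
      finally show ?thesis
        by (simp add: gauss_def ennreal_mult[symmetric] exp_add[symmetric] add_divide_distrib diff_divide_distrib)
    qed
    have "(\<integral>\<^sup>+t. F (restrict (x(r := t)) I) * G ((x(r := t)) r + s (x(r := t))) *
        gauss (insert r I) P m (x(r := t)) \<partial>lborel) =
      (\<integral>\<^sup>+t. F x * gauss I (schur r P) m x *
        (G (s x + 1 * t) * ennreal (exp (- (P r r * (s x + 1 * t)\<^sup>2) / 2))) \<partial>lborel)"
      unfolding 1 2 3 by (simp add: add.commute mult_ac)
    also have "\<dots> = F x * gauss I (schur r P) m x *
        (\<integral>\<^sup>+t. G (s x + 1 * t) * ennreal (exp (- (P r r * (s x + 1 * t)\<^sup>2) / 2)) \<partial>lborel)"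
      by (rule nn_integral_cmult) (rule G')
    also have "(\<integral>\<^sup>+t. G (s x + 1 * t) * ennreal (exp (- (P r r * (s x + 1 * t)\<^sup>2) / 2)) \<partial>lborel) =
        (\<integral>\<^sup>+t. G t * ennreal (exp (- (P r r * t\<^sup>2) / 2)) \<partial>lborel)"
      using nn_integral_real_affine[OF G'', of 1 "s x"] by simp
    finally show "(\<integral>\<^sup>+t. F (restrict (x(r := t)) I) * G ((x(r := t)) r + s (x(r := t))) *
        gauss (insert r I) P m (x(r := t)) \<partial>lborel) = F x * gauss I (schur r P) m x *
        (\<integral>\<^sup>+t. G t * ennreal (exp (- (P r r * t\<^sup>2) / 2)) \<partial>lborel)" .
  qed
  also have "\<dots> = (\<integral>\<^sup>+x. F x * gauss I (schur r P) m x \<partial>Pi\<^sub>M I (\<lambda>_. lborel)) *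
      (\<integral>\<^sup>+t. G t * ennreal (exp (- (P r r * t\<^sup>2) / 2)) \<partial>lborel)"
    by (rule nn_integral_multc) measurable
  moreover have "x r - m r + (\<Sum>i\<in>I. P r i / P r r * (x i - m i)) = x r + s x" for x
    by (simp add: s_def)
  ultimately show ?thesis by (simp only:)
qed

lemma exp_eq_normal_density:
  assumes "0 < p"
  shows "exp (- (p * t\<^sup>2) / 2) = sqrt (2 * pi / p) * normal_density 0 (1 / sqrt p) t"
  using assms by (simp add: normal_density_def real_sqrt_divide power_divide field_simps real_sqrt_mult)

text \<open>The constant is existential: on a probability space total mass 1 determines it, and the
  covariance criteria never need its value, so elimination steps need no determinants.\<close>

definition gaussian_on ::
  "'a measure \<Rightarrow> 'i set \<Rightarrow> ('i \<Rightarrow> 'a \<Rightarrow> real) \<Rightarrow> ('i \<Rightarrow> real) \<Rightarrow> ('i \<Rightarrow> 'i \<Rightarrow> real) \<Rightarrow> bool" where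
  "gaussian_on M I X m P \<longleftrightarrow>
     (\<exists>c. distributed M (Pi\<^sub>M I (\<lambda>_. lborel)) (\<lambda>\<omega>. \<lambda>i\<in>I. X i \<omega>) (\<lambda>x. c * gauss I P m x))"

lemma gaussian_on_measurable:
  assumes "gaussian_on M I X m P" "i \<in> I"
  shows "X i \<in> borel_measurable M"
proof -
  have 1: "(\<lambda>\<omega>. \<lambda>i\<in>I. X i \<omega>) \<in> M \<rightarrow>\<^sub>M Pi\<^sub>M I (\<lambda>_. lborel)"
    using assms by (auto simp: gaussian_on_def distributed_def)
  have 2: "(\<lambda>x. x i) \<in> borel_measurable (Pi\<^sub>M I (\<lambda>_. lborel))"
    using measurable_component_singleton[of i I "\<lambda>_. lborel :: real measure"] assms by auto
  show ?thesis using measurable_comp[OF 1 2] assms by (simp add: comp_def)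
qed

text \<open>All three claims are read off one factorisation, \<open>main\<close>: the choice
  \<open>G = 1\<close> gives the marginal law, \<open>F = 1\<close> the law of the residual
  \<open>T\<close>, and the general case their independence. The regression coefficient of
  \<open>X r\<close> on \<open>X i\<close> is \<open>- P r i / P r r\<close>, which explains the
  plus sign in \<open>T\<close>.\<close>

lemma (in prob_space)
  fixes X :: "'i \<Rightarrow> 'a \<Rightarrow> real"
  assumes I: "finite I" "r \<notin> I" and P: "pos_def_on (insert r I) P"
    and X: "gaussian_on M (insert r I) X m P"
  defines "T \<equiv> \<lambda>\<omega>. X r \<omega> - m r + (\<Sum>i\<in>I. P r i / P r r * (X i \<omega> - m i))"
  shows gaussian_on_schur: "gaussian_on M I X m (schur r P)"
    and distributed_residual: "distributed M lborel T (normal_density 0 (1 / sqrt (P r r)))"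
    and indep_rv_residual: "indep_rv (Pi\<^sub>M I (\<lambda>_. lborel)) (\<lambda>\<omega>. \<lambda>i\<in>I. X i \<omega>) borel T"
proof -
  let ?N = "Pi\<^sub>M (insert r I) (\<lambda>_. lborel :: real measure)"
  let ?NI = "Pi\<^sub>M I (\<lambda>_. lborel :: real measure)"
  let ?X = "\<lambda>\<omega>. \<lambda>i\<in>I. X i \<omega>"
  have pos: "0 < P r r" using pos_def_on_diag[OF P] I by auto
  have meas [measurable]: "X i \<in> borel_measurable M" if "i \<in> insert r I" for i
    using gaussian_on_measurable[OF X] that by blast
  obtain c where c: "distributed M ?N (\<lambda>\<omega>. \<lambda>i\<in>insert r I. X i \<omega>) (\<lambda>x. c * gauss (insert r I) P m x)"
    using X unfolding gaussian_on_def by blast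
  \<comment> \<open>The mass of the one-dimensional Gaussian is moved into \<open>K\<close>, so that
    \<open>R\<close> integrates against a probability density.\<close>
  define K where "K = c * ennreal (sqrt (2 * pi / P r r))"
  let ?n = "normal_density 0 (1 / sqrt (P r r))"
  define L where "L F = (\<integral>\<^sup>+x. (K * gauss I (schur r P) m x) * F x \<partial>?NI)" for F
  define R where "R G = (\<integral>\<^sup>+t. ennreal (?n t) * G t \<partial>lborel)" for G
  have comp: "(\<lambda>x. x i) \<in> borel_measurable ?N" if "i \<in> insert r I" for i
    using measurable_component_singleton[of i "insert r I" "\<lambda>_. lborel :: real measure"] that by auto
  have gI: "gauss I (schur r P) m \<in> borel_measurable ?NI"
    by (rule gauss_measurable) simp
  have gN: "gauss (insert r I) P m \<in> borel_measurable ?N"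
    by (rule gauss_measurable) simp
  have XI: "?X \<in> M \<rightarrow>\<^sub>M ?NI"
    by (rule measurable_restrict) (use meas in auto)
  have T: "T \<in> borel_measurable M"
    unfolding T_def by measurable
  have main: "(\<integral>\<^sup>+\<omega>. F (?X \<omega>) * G (T \<omega>) \<partial>M) = L F * R G"
    if F [measurable]: "F \<in> borel_measurable ?NI" and G [measurable]: "G \<in> borel_measurable borel" for F G
  proof -
    define g where "g x = F (restrict x I) * G (x r - m r + (\<Sum>i\<in>I. P r i / P r r * (x i - m i)))" for x
    have restr: "(\<lambda>x. restrict x I) \<in> ?N \<rightarrow>\<^sub>M ?NI"
      by (rule measurable_restrict_subset) auto
    have "(\<lambda>x. x r - m r + (\<Sum>i\<in>I. P r i / P r r * (x i - m i))) \<in> borel_measurable ?N"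
      using comp by (intro borel_measurable_add borel_measurable_diff borel_measurable_sum borel_measurable_times) auto
    then have g: "g \<in> borel_measurable ?N"
      unfolding g_def using measurable_compose[OF restr F] measurable_compose[OF _ G]
      by (intro borel_measurable_times_ennreal)
    have "F (?X \<omega>) * G (T \<omega>) = g (\<lambda>i\<in>insert r I. X i \<omega>)" for \<omega>
    proof -
      have "restrict (\<lambda>i\<in>insert r I. X i \<omega>) I = ?X \<omega>"
        by (auto simp: restrict_def fun_eq_iff)
      moreover have "(\<Sum>i\<in>I. P r i / P r r * ((\<lambda>i\<in>insert r I. X i \<omega>) i - m i)) =
          (\<Sum>i\<in>I. P r i / P r r * (X i \<omega> - m i))"
        by (intro sum.cong) auto
      ultimately show ?thesis unfolding g_def T_def by simp
    qed
    then have "(\<integral>\<^sup>+\<omega>. F (?X \<omega>) * G (T \<omega>) \<partial>M) = (\<integral>\<^sup>+x. (c * gauss (insert r I) P m x) * g x \<partial>?N)"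
      using distributed_nn_integral[OF c g] by simp
    also have "\<dots> = (\<integral>\<^sup>+x. c * (g x * gauss (insert r I) P m x) \<partial>?N)"
      by (simp add: mult_ac)
    also have "\<dots> = c * (\<integral>\<^sup>+x. g x * gauss (insert r I) P m x \<partial>?N)"
      using g gN by (intro nn_integral_cmult borel_measurable_times_ennreal)
    also have "(\<integral>\<^sup>+x. g x * gauss (insert r I) P m x \<partial>?N) =
      (\<integral>\<^sup>+x. F x * gauss I (schur r P) m x \<partial>?NI) * (\<integral>\<^sup>+t. G t * ennreal (exp (- (P r r * t\<^sup>2) / 2)) \<partial>lborel)"
      unfolding g_def by (rule nn_integral_gauss_insert[OF I P F G])
    also have "(\<integral>\<^sup>+t. G t * ennreal (exp (- (P r r * t\<^sup>2) / 2)) \<partial>lborel) = ennreal (sqrt (2 * pi / P r r)) * R G"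
      unfolding R_def exp_eq_normal_density[OF pos]
      by (subst nn_integral_cmult[symmetric]) (use pos in \<open>auto simp: ennreal_mult mult_ac\<close>)
    also have "c * ((\<integral>\<^sup>+x. F x * gauss I (schur r P) m x \<partial>?NI) * (ennreal (sqrt (2 * pi / P r r)) * R G)) =
       (K * (\<integral>\<^sup>+x. F x * gauss I (schur r P) m x \<partial>?NI)) * R G"
      by (simp add: K_def mult_ac)
    also have "K * (\<integral>\<^sup>+x. F x * gauss I (schur r P) m x \<partial>?NI) = L F"
      unfolding L_def using F gI by (subst nn_integral_cmult[symmetric]) (auto simp: mult_ac)
    finally show ?thesis .
  qed
  have R1: "R (\<lambda>_. 1) = 1"
    using pos by (simp add: R_def nn_integral_eq_integral)
  \<comment> \<open>For \<open>F = G = 1\<close> the factorisation reads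
    \<open>1 = L 1 * R 1\<close>; hence \<open>K\<close> normalises the marginal although
    \<open>c\<close> is unknown.\<close>
  have L1: "L (\<lambda>_. 1) = 1"
    using main[of "\<lambda>_. 1" "\<lambda>_. 1"] by (simp add: R1 emeasure_space_1)
  have mainL: "(\<integral>\<^sup>+\<omega>. F (?X \<omega>) \<partial>M) = L F" if "F \<in> borel_measurable ?NI" for F
    using main[OF that, of "\<lambda>_. 1"] by (simp add: R1)
  have mainR: "(\<integral>\<^sup>+\<omega>. G (T \<omega>) \<partial>M) = R G" if "G \<in> borel_measurable borel" for G
    using main[OF _ that, of "\<lambda>_. 1"] by (simp add: L1)
  have "distributed M ?NI ?X (\<lambda>x. K * gauss I (schur r P) m x)"
    using XI gI mainL by (intro distributed_nn_integralI) (auto simp: L_def)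
  then show "gaussian_on M I X m (schur r P)" unfolding gaussian_on_def by blast
  show "distributed M lborel T ?n"
    using T mainR by (intro distributed_nn_integralI) (auto simp: R_def)
  show "indep_rv ?NI ?X borel T"
    using XI T by (intro indep_rv_nn_integralI) (auto simp: main mainL mainR)
qed

section \<open>From independence to vanishing covariances\<close>

lemma (in prob_space) indep_var_add_multiple_iff:
  assumes \<sigma>: "0 < \<sigma>" and A: "distributed M lborel A (normal_density 0 \<sigma>)"
    and \<tau>: "0 < \<tau>" and T: "distributed M lborel T (normal_density 0 \<tau>)"
    and ind: "indep_var borel A borel T"
  shows "indep_var borel A borel (\<lambda>\<omega>. T \<omega> + c * A \<omega>) \<longleftrightarrow> c = 0"
proof
  assume ind': "indep_var borel A borel (\<lambda>\<omega>. T \<omega> + c * A \<omega>)"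
  have int [simp]: "integrable M A" "integrable M T"
    using distributed_integrable_var[OF A] distributed_integrable_var[OF T]
      integrable_normal_moment_nz_1[OF \<sigma>, of 0] integrable_normal_moment_nz_1[OF \<tau>, of 0] by auto
  have E [simp]: "expectation A = 0" "expectation T = 0"
    using normal_distributed_expectation[OF \<sigma> A] normal_distributed_expectation[OF \<tau> T] by auto
  have "integrable M (\<lambda>\<omega>. (A \<omega>)\<^sup>2)"
    using distributed_integrable[OF A, of "\<lambda>x. x\<^sup>2"] integrable_normal_moment[OF \<sigma>, of 0 2] by simp
  then have int2: "integrable M (\<lambda>\<omega>. A \<omega> * A \<omega>)" by (simp add: power2_eq_square)
  have var: "expectation (\<lambda>\<omega>. A \<omega> * A \<omega>) = \<sigma>\<^sup>2"
    using normal_distributed_variance[OF \<sigma> A] by (simp add: power2_eq_square)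
  have AT: "expectation (\<lambda>\<omega>. A \<omega> * T \<omega>) = 0" "integrable M (\<lambda>\<omega>. A \<omega> * T \<omega>)"
    using indep_var_lebesgue_integral[OF ind] indep_var_integrable[OF ind] by auto
  \<comment> \<open>The covariance of \<open>A\<close> with \<open>T + c * A\<close> is computed
    twice: independence makes it 0, and expanding the product makes it \<open>c\<close> times the
    variance of \<open>A\<close>.\<close>
  have "0 = expectation (\<lambda>\<omega>. A \<omega> * (T \<omega> + c * A \<omega>))"
    using indep_var_lebesgue_integral[OF ind'] by simp
  also have "\<dots> = expectation (\<lambda>\<omega>. A \<omega> * T \<omega> + c * (A \<omega> * A \<omega>))"
    by (simp add: algebra_simps)
  also have "\<dots> = c * \<sigma>\<^sup>2"
    using AT int2 by (simp add: var)
  finally show "c = 0" using \<sigma> by simp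
qed (use ind in simp)

text \<open>The variables in \<open>K\<close> are integrated out one at a time. The induction
  generalises over \<open>P\<close>, which changes at each step, and keeps \<open>S\<close>
  fixed.\<close>

lemma (in prob_space) gaussian_on_marginal:
  assumes "finite K" "finite J" "J \<inter> K = {}"
    and "pos_def_on (J \<union> K) P" "inverse_on (J \<union> K) P S" "gaussian_on M (J \<union> K) X m P"
  shows "\<exists>P'. pos_def_on J P' \<and> inverse_on J P' S \<and> gaussian_on M J X m P'"
  using assms
proof (induction K arbitrary: P rule: finite_induct)
  case empty
  then show ?case by auto
next
  case (insert r K)
  have eq: "J \<union> insert r K = insert r (J \<union> K)" by simp
  have fin: "finite (J \<union> K)" "r \<notin> J \<union> K" using insert by auto
  note P = insert.prems(3-5)[unfolded eq]
  have "P r r \<noteq> 0" using pos_def_on_diag[OF P(1), of r] fin by simp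
  then show ?case
    using insert.prems(1,2) pos_def_on_schur[OF P(1) fin] inverse_on_schur[OF P(2) fin]
      gaussian_on_schur[OF fin P(1,3)]
    by (intro insert.IH) auto
qed

lemma (in prob_space) gaussian_on_subset:
  assumes "finite I" "J \<subseteq> I" "pos_def_on I P" "inverse_on I P S" "gaussian_on M I X m P"
  obtains P' where "pos_def_on J P'" "inverse_on J P' S" "gaussian_on M J X m P'"
proof -
  have I: "J \<union> (I - J) = I" using assms(2) by auto
  have "\<exists>P'. pos_def_on J P' \<and> inverse_on J P' S \<and> gaussian_on M J X m P'"
    by (rule gaussian_on_marginal[of "I - J" J P S X m]) (use assms I finite_subset in auto)
  then show ?thesis using that by blast
qed

text \<open>With no variables left to regress on, the residual is the centred variable
  itself.\<close>

lemma (in prob_space) gaussian_on_singleton: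
  assumes P: "pos_def_on {k} P" and X: "gaussian_on M {k} X m P"
  shows "distributed M lborel (\<lambda>\<omega>. X k \<omega> - m k) (normal_density 0 (1 / sqrt (P k k)))"
  using distributed_residual[of "{}" k P X m] assms by simp

lemma (in prob_space) gaussian_on_pair:
  fixes X :: "'i \<Rightarrow> 'a \<Rightarrow> real"
  assumes ki: "k \<noteq> i" and P: "pos_def_on {k, i} P" and X: "gaussian_on M {k, i} X m P"
  defines "T \<equiv> \<lambda>\<omega>. X i \<omega> - m i + P i k / P i i * (X k \<omega> - m k)"
  shows "distributed M lborel T (normal_density 0 (1 / sqrt (P i i)))" "indep_rv borel (X k) borel T"
    and "\<exists>\<sigma>>0. distributed M lborel (\<lambda>\<omega>. X k \<omega> - m k) (normal_density 0 \<sigma>)"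
proof -
  have eq: "{k, i} = insert i {k}" by auto
  have I: "finite {k}" "i \<notin> {k}" using ki by auto
  note P' = P[unfolded eq] and X' = X[unfolded eq]
  show "distributed M lborel T (normal_density 0 (1 / sqrt (P i i)))"
    using distributed_residual[OF I P' X'] by (simp add: T_def)
  have "(\<lambda>x. x k) \<in> borel_measurable (Pi\<^sub>M {k} (\<lambda>_. lborel :: real measure))"
    using measurable_component_singleton[of k "{k}" "\<lambda>_. lborel :: real measure"] by simp
  from indep_rv_compose[OF indep_rv_residual[OF I P' X'] this measurable_ident]
  show "indep_rv borel (X k) borel T" by (simp add: T_def)
  have Q: "pos_def_on {k} (schur i P)" by (rule pos_def_on_schur[OF P' I])
  have "0 < schur i P k k" using pos_def_on_diag[OF Q, of k] by simp
  with gaussian_on_singleton[OF Q gaussian_on_schur[OF I P' X']]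
  show "\<exists>\<sigma>>0. distributed M lborel (\<lambda>\<omega>. X k \<omega> - m k) (normal_density 0 \<sigma>)"
    by (intro exI[of _ "1 / sqrt (schur i P k k)"]) auto
qed

text \<open>In the marginal of the pair, \<open>X i\<close> is a multiple of \<open>X k\<close> plus
  an independent residual, up to constants. Independence therefore means that the multiple is zero,
  that is, that the off-diagonal entry of the 2x2 inverse covariance vanishes.\<close>

lemma (in prob_space) indep_var_iff_covariance_zero:
  fixes X :: "'i \<Rightarrow> 'a \<Rightarrow> real"
  assumes I: "finite I" "k \<in> I" "i \<in> I" and ki: "k \<noteq> i"
    and P: "pos_def_on I P" and inv: "inverse_on I P S" and S: "pos_def_on I S"
    and X: "gaussian_on M I X m P"
  shows "indep_var borel (X k) borel (X i) \<longleftrightarrow> S k i = 0"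
proof -
  have sub: "{k, i} \<subseteq> I" using I by simp
  obtain Q where Q: "pos_def_on {k, i} Q" "inverse_on {k, i} Q S" "gaussian_on M {k, i} X m Q"
    by (rule gaussian_on_subset[OF I(1) sub P inv X])
  define c where "c = Q i k / Q i i"
  define T where "T = (\<lambda>\<omega>. X i \<omega> - m i + c * (X k \<omega> - m k))"
  note pair = gaussian_on_pair[OF ki Q(1,3), folded c_def, folded T_def]
  obtain \<sigma> where \<sigma>: "0 < \<sigma>" "distributed M lborel (\<lambda>\<omega>. X k \<omega> - m k) (normal_density 0 \<sigma>)"
    using pair(3) by blast
  have pos: "0 < Q i i" using pos_def_on_diag[OF Q(1), of i] by simp
  have "indep_rv borel (\<lambda>\<omega>. X k \<omega> - m k) borel T"
    by (rule indep_rv_compose[OF pair(2), of "\<lambda>x. x - m k" borel "\<lambda>x. x" borel]) simp_all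
  then have ind: "indep_var borel (\<lambda>\<omega>. X k \<omega> - m k) borel T" by (simp only: indep_var_iff_indep_rv)
  have "indep_var borel (X k) borel (X i) \<longleftrightarrow>
      indep_var borel (\<lambda>\<omega>. X k \<omega> - m k) borel (\<lambda>\<omega>. X i \<omega> - m i)"
    using indep_var_shift[of "X k" "- m k" "X i" "- m i"] by simp
  also have "(\<lambda>\<omega>. X i \<omega> - m i) = (\<lambda>\<omega>. T \<omega> + (- c) * (X k \<omega> - m k))"
    by (simp add: T_def)
  also have "indep_var borel (\<lambda>\<omega>. X k \<omega> - m k) borel \<dots> \<longleftrightarrow> - c = 0"
    by (rule indep_var_add_multiple_iff[OF \<sigma> _ pair(1) ind]) (use pos in simp)
  also have "\<dots> \<longleftrightarrow> Q i k = 0" using pos by (simp add: c_def)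
  also have "\<dots> \<longleftrightarrow> S k i = 0"
    by (rule inverse_on_pair[OF Q(2,1) pos_def_on_subset[OF S sub I(1)] ki])
  finally show ?thesis .
qed

lemma (in prob_space) cond_indep_var_iff_covariance:
  fixes X :: "'i \<Rightarrow> 'a \<Rightarrow> real"
  assumes I: "finite I" "i \<in> I" "j \<in> I" "k \<in> I" and ne: "k \<noteq> i" "k \<noteq> j" "i \<noteq> j"
    and P: "pos_def_on I P" and inv: "inverse_on I P S" and S: "pos_def_on I S"
    and X: "gaussian_on M I X m P"
  shows "cond_indep_var M (X i) (X j) (X k) \<longleftrightarrow> S i j * S k k = S i k * S j k"
proof -
  have sub: "{k, i, j} \<subseteq> I" using I by simp
  obtain Q where Q: "pos_def_on {k, i, j} Q" "inverse_on {k, i, j} Q S" "gaussian_on M {k, i, j} X m Q"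
    by (rule gaussian_on_subset[OF I(1) sub P inv X])
  \<comment> \<open>The set is written in this order to eliminate \<open>j\<close> first and then
    \<open>i\<close>, which leaves the conditioning variable \<open>k\<close> to the end.\<close>
  have eq: "{k, i, j} = insert j {k, i}" by auto
  have J: "finite {k, i}" "j \<notin> {k, i}" using ne by auto
  note Qj = Q(1)[unfolded eq] and Xj = Q(3)[unfolded eq]
  define R where "R = schur j Q"
  have R: "pos_def_on {k, i} R" unfolding R_def by (rule pos_def_on_schur[OF Qj J])
  have XR: "gaussian_on M {k, i} X m R" unfolding R_def by (rule gaussian_on_schur[OF J Qj Xj])
  define \<alpha> \<beta> \<gamma> where "\<alpha> = Q j i / Q j j" and "\<beta> = Q j k / Q j j" and "\<gamma> = R i k / R i i"
  define T where "T = (\<lambda>\<omega>. X i \<omega> - m i + \<gamma> * (X k \<omega> - m k))"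
  define T' where "T' = (\<lambda>\<omega>. X j \<omega> - m j + (\<beta> * (X k \<omega> - m k) + \<alpha> * (X i \<omega> - m i)))"
  have posj: "0 < Q j j" using pos_def_on_diag[OF Q(1), of j] by simp
  have posi: "0 < R i i" using pos_def_on_diag[OF R, of i] by simp
  note pair = gaussian_on_pair[OF ne(1) R XR, folded \<gamma>_def, folded T_def]
  have T'_eq: "(\<lambda>\<omega>. X j \<omega> - m j + (\<Sum>l\<in>{k, i}. Q j l / Q j j * (X l \<omega> - m l))) = T'"
    using ne(1) by (simp add: T'_def \<alpha>_def \<beta>_def)
  have T': "distributed M lborel T' (normal_density 0 (1 / sqrt (Q j j)))"
    using distributed_residual[OF J Qj Xj] unfolding T'_eq .
  have comp: "(\<lambda>x. x l) \<in> borel_measurable (Pi\<^sub>M {k, i} (\<lambda>_. lborel :: real measure))" if "l \<in> {k, i}" for l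
    using measurable_component_singleton[of l "{k, i}" "\<lambda>_. lborel :: real measure"] that by simp
  have comp': "(\<lambda>x. (x k, x i - m i + \<gamma> * (x k - m k))) \<in>
      Pi\<^sub>M {k, i} (\<lambda>_. lborel :: real measure) \<rightarrow>\<^sub>M borel \<Otimes>\<^sub>M borel"
    using comp[of k] comp[of i] by measurable
  have "indep_rv (Pi\<^sub>M {k, i} (\<lambda>_. lborel)) (\<lambda>\<omega>. \<lambda>l\<in>{k, i}. X l \<omega>) borel T'"
    using indep_rv_residual[OF J Qj Xj] unfolding T'_eq .
  from indep_rv_compose[OF this comp' measurable_ident]
  have "indep_rv (borel \<Otimes>\<^sub>M borel) (\<lambda>\<omega>. (X k \<omega>, T \<omega>)) borel T'"
    by (simp add: T_def)
  \<comment> \<open>\<open>T\<close> is independent of \<open>X k\<close>, and \<open>T'\<close> of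
    the pair \<open>(X k, T)\<close>. Regrouping makes the pair \<open>(T, T')\<close> independent
    of \<open>X k\<close>, as the criterion for conditional independence requires.\<close>
  note TT' = indep_rv_Pair[OF pair(2) this] and T_ind = indep_rv_compose[OF this measurable_snd measurable_ident]
  \<comment> \<open>Replacing \<open>X i\<close> by its regression on \<open>X k\<close> in the
    regression of \<open>X j\<close> on both shows that the part of \<open>X j\<close> not explained
    by \<open>X k\<close> is \<open>T' - \<alpha> * T\<close>. The added constants absorb the means,
    so that \<open>X i\<close> and \<open>X j\<close> are exactly \<open>U\<close> and
    \<open>V\<close> plus multiples of the uncentred \<open>X k\<close>.\<close>
  define U V where "U = (\<lambda>\<omega>. T \<omega> + (m i + \<gamma> * m k))"
    and "V = (\<lambda>\<omega>. (T' \<omega> + (- \<alpha>) * T \<omega>) + (m j + (\<beta> - \<alpha> * \<gamma>) * m k))"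
  have "indep_rv (borel \<Otimes>\<^sub>M borel) (\<lambda>\<omega>. (U \<omega>, V \<omega>)) borel (X k)"
    unfolding U_def V_def
    by (rule indep_rv_compose[OF TT', of "\<lambda>w. (fst w + (m i + \<gamma> * m k),
        (snd w + (- \<alpha>) * fst w) + (m j + (\<beta> - \<alpha> * \<gamma>) * m k))" "borel \<Otimes>\<^sub>M borel" "\<lambda>x. x" borel, unfolded fst_conv snd_conv])
      measurable
  moreover have "X i \<omega> = U \<omega> + (- \<gamma>) * X k \<omega>" for \<omega>
    by (simp add: U_def T_def algebra_simps)
  moreover have "X j \<omega> = V \<omega> + (\<alpha> * \<gamma> - \<beta>) * X k \<omega>" for \<omega>
    by (simp add: V_def T_def T'_def algebra_simps)
  ultimately have "cond_indep_var M (X i) (X j) (X k) \<longleftrightarrow> indep_var borel U borel V"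
    by (rule cond_indep_var_iff_indep_residuals)
  also have "\<dots> \<longleftrightarrow> indep_var borel T borel (\<lambda>\<omega>. T' \<omega> + (- \<alpha>) * T \<omega>)"
    unfolding U_def V_def by (rule indep_var_shift)
  also have "\<dots> \<longleftrightarrow> - \<alpha> = 0"
  proof (rule indep_var_add_multiple_iff[OF _ pair(1) _ T'])
    show "indep_var borel T borel T'" using T_ind by (simp add: indep_var_iff_indep_rv)
  qed (use posi posj in auto)
  also have "\<dots> \<longleftrightarrow> Q j i = 0" using posj by (simp add: \<alpha>_def)
  also have "\<dots> \<longleftrightarrow> S i j * S k k = S i k * S j k"
    by (rule inverse_on_triple[OF Q(2,1) pos_def_on_subset[OF S sub I(1)] ne])
  finally show ?thesis .
qed

section \<open>Covariance matrices\<close>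

lemma scalar_prod_mult_mat_vec_eq_quad:
  assumes "A \<in> carrier_mat n n"
  shows "Matrix.vec n v \<bullet> (A *\<^sub>v Matrix.vec n v) = quad {..<n} (\<lambda>i j. A $$ (i, j)) v"
  using assms
  by (simp add: quad_def scalar_prod_def sum_distrib_left lessThan_atLeast0 mult_ac)

lemma inverse_on_lessThan_iff:
  assumes "A \<in> carrier_mat n n" "B \<in> carrier_mat n n"
  shows "inverse_on {..<n} (\<lambda>i j. B $$ (i, j)) (\<lambda>i j. A $$ (i, j)) \<longleftrightarrow> B * A = 1\<^sub>m n"
proof -
  have entry: "(B * A) $$ (i, k) = (\<Sum>j\<in>{..<n}. B $$ (i, j) * A $$ (j, k))" if "i < n" "k < n" for i k
    using assms that by (simp add: scalar_prod_def lessThan_atLeast0)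
  have "B * A = 1\<^sub>m n \<longleftrightarrow> (\<forall>i<n. \<forall>k<n. (B * A) $$ (i, k) = 1\<^sub>m n $$ (i, k))"
    using assms by (auto simp del: index_mult_mat(1))
  also have "\<dots> \<longleftrightarrow> inverse_on {..<n} (\<lambda>i j. B $$ (i, j)) (\<lambda>i j. A $$ (i, j))"
    unfolding inverse_on_def using entry by auto
  finally show ?thesis by simp
qed

lemma positive_definite_mat_iff_pos_def_on:
  assumes A: "A \<in> carrier_mat n n"
  shows "positive_definite_mat A \<longleftrightarrow> pos_def_on {..<n} (\<lambda>i j. A $$ (i, j))"
proof -
  have "transpose_mat A = A \<longleftrightarrow> (\<forall>i\<in>{..<n}. \<forall>j\<in>{..<n}. A $$ (i, j) = A $$ (j, i))"
    using A by (auto simp: mat_eq_iff)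
  moreover have "(\<forall>v \<in> carrier_vec n. v \<noteq> 0\<^sub>v n \<longrightarrow> v \<bullet> (A *\<^sub>v v) > 0) \<longleftrightarrow>
    (\<forall>v. (\<exists>i\<in>{..<n}. v i \<noteq> 0) \<longrightarrow> 0 < quad {..<n} (\<lambda>i j. A $$ (i, j)) v)"
  proof (intro iffI allI impI ballI)
    fix v :: "nat \<Rightarrow> real"
    assume *: "\<forall>v \<in> carrier_vec n. v \<noteq> 0\<^sub>v n \<longrightarrow> v \<bullet> (A *\<^sub>v v) > 0" and "\<exists>i\<in>{..<n}. v i \<noteq> 0"
    then have "Matrix.vec n v \<noteq> 0\<^sub>v n" by (auto simp: vec_eq_iff)
    with * show "0 < quad {..<n} (\<lambda>i j. A $$ (i, j)) v"
      unfolding scalar_prod_mult_mat_vec_eq_quad[OF A, symmetric] by simp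
  next
    fix v :: "real vec"
    assume *: "\<forall>v. (\<exists>i\<in>{..<n}. v i \<noteq> 0) \<longrightarrow> 0 < quad {..<n} (\<lambda>i j. A $$ (i, j)) v"
      and v: "v \<in> carrier_vec n" "v \<noteq> 0\<^sub>v n"
    have "v = Matrix.vec n (\<lambda>i. v $ i)" using v by auto
    moreover have "\<exists>i\<in>{..<n}. v $ i \<noteq> 0" using v by (auto simp: vec_eq_iff)
    ultimately show "v \<bullet> (A *\<^sub>v v) > 0"
      using * scalar_prod_mult_mat_vec_eq_quad[OF A, of "\<lambda>i. v $ i"] by auto
  qed
  ultimately show ?thesis
    using A unfolding positive_definite_mat_def pos_def_on_def by auto
qed

text \<open>A kernel vector of \<open>S\<close> would make the form vanish, so \<open>S\<close> is
  invertible. The form of the inverse \<open>B\<close> at \<open>v\<close> is the form of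
  \<open>S\<close> at \<open>B v\<close>, hence positive.\<close>

lemma positive_definite_mat_inverse:
  assumes S: "S \<in> carrier_mat n n" and pd: "positive_definite_mat S"
  obtains B where "mat_inverse S = Some B" "B \<in> carrier_mat n n" "B * S = 1\<^sub>m n" "S * B = 1\<^sub>m n"
    "positive_definite_mat B"
proof -
  have pos: "v \<bullet> (S *\<^sub>v v) > 0" if "v \<in> carrier_vec n" "v \<noteq> 0\<^sub>v n" for v
    using pd S that by (auto simp: positive_definite_mat_def)
  have symS: "transpose_mat S = S" using pd by (simp add: positive_definite_mat_def)
  have "Determinant.det S \<noteq> 0"
  proof
    assume "Determinant.det S = 0"
    then obtain v where v: "v \<in> carrier_vec n" "v \<noteq> 0\<^sub>v n" "S *\<^sub>v v = 0\<^sub>v n"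
      using det_0_iff_vec_prod_zero[OF S] by auto
    with pos[OF v(1,2)] show False by simp
  qed
  then have "S \<in> Units (ring_mat TYPE(real) n ())" by (rule det_non_zero_imp_unit[OF S])
  then have "mat_inverse S \<noteq> None" using mat_inverse(1)[OF S, where b = "()"] by blast
  then obtain B where B: "mat_inverse S = Some B" by blast
  have B': "S * B = 1\<^sub>m n" "B * S = 1\<^sub>m n" "B \<in> carrier_mat n n"
    using mat_inverse(2)[OF S B] by auto
  \<comment> \<open>By symmetry of \<open>S\<close> the transpose of \<open>B\<close> is also a left
    inverse of \<open>S\<close>, and it coincides with the right inverse \<open>B\<close>.\<close>
  have "transpose_mat B * S = 1\<^sub>m n"
    using transpose_mult[OF S B'(3)] B' symS by simp
  then have "transpose_mat B = transpose_mat B * (S * B)" "transpose_mat B * S * B = B"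
    using B' by auto
  then have symB: "transpose_mat B = B"
    using assoc_mult_mat[of "transpose_mat B" n n S n B n] S B' by simp
  have "positive_definite_mat B"
    unfolding positive_definite_mat_def
  proof (intro conjI ballI impI)
    fix v :: "real vec" assume v: "v \<in> carrier_vec (dim_row B)" "v \<noteq> 0\<^sub>v (dim_row B)"
    then have v': "v \<in> carrier_vec n" "v \<noteq> 0\<^sub>v n" using B' by auto
    define w where "w = B *\<^sub>v v"
    have w: "w \<in> carrier_vec n" using B' v' by (simp add: w_def)
    have Sw: "S *\<^sub>v w = v"
      unfolding w_def using assoc_mult_mat_vec[OF S B'(3) v'(1)] B' v' by simp
    have "w \<noteq> 0\<^sub>v n" using Sw v' S by auto
    from pos[OF w this] have "0 < w \<bullet> v" unfolding Sw .
    then show "v \<bullet> (B *\<^sub>v v) > 0"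
      using comm_scalar_prod[OF w v'(1)] by (simp add: w_def)
  qed (use symB B' in auto)
  with B B' show ?thesis using that by blast
qed

lemma mv_normal_density_eq_gauss:
  assumes m: "m \<in> carrier_vec n" and B: "mat_inverse S = Some B" "B \<in> carrier_mat n n"
  shows "ennreal (mv_normal_density m S (Matrix.vec n x)) =
    ennreal (1 / sqrt ((2 * pi) ^ n * Determinant.det S)) *
    gauss {..<n} (\<lambda>i j. B $$ (i, j)) (\<lambda>i. m $ i) x"
proof -
  have "Matrix.vec n x - m = Matrix.vec n (\<lambda>i. x i - m $ i)" using m by auto
  then show ?thesis
    using m B scalar_prod_mult_mat_vec_eq_quad[OF B(2), of "\<lambda>i. x i - m $ i"]
    by (simp add: mv_normal_density_def gauss_def ennreal_mult''[symmetric])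
qed

lemma gaussian_vector_gaussian_on:
  assumes "gaussian_vector M n X m S"
  obtains P where "pos_def_on {..<n} P" "inverse_on {..<n} P (\<lambda>i j. S $$ (i, j))"
    "pos_def_on {..<n} (\<lambda>i j. S $$ (i, j))" "gaussian_on M {..<n} X (\<lambda>i. m $ i) P"
proof -
  have m: "m \<in> carrier_vec n" and S: "S \<in> carrier_mat n n" and pd: "positive_definite_mat S"
    and X: "distributed M (\<Pi>\<^sub>M i\<in>{..<n}. lborel) (\<lambda>\<omega>. \<lambda>i\<in>{..<n}. X i \<omega>)
       (\<lambda>x. ennreal (mv_normal_density m S (Matrix.vec n x)))"
    using assms by (auto simp: gaussian_vector_def)
  obtain B where B: "mat_inverse S = Some B" "B \<in> carrier_mat n n" "B * S = 1\<^sub>m n" "positive_definite_mat B"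
    using positive_definite_mat_inverse[OF S pd] by metis
  let ?P = "\<lambda>i j. B $$ (i, j)"
  have "gaussian_on M {..<n} X (\<lambda>i. m $ i) ?P"
    using X unfolding gaussian_on_def mv_normal_density_eq_gauss[OF m B(1,2)] by blast
  moreover have "inverse_on {..<n} ?P (\<lambda>i j. S $$ (i, j))"
    using B(3) by (simp add: inverse_on_lessThan_iff[OF S B(2)])
  moreover have "pos_def_on {..<n} ?P" "pos_def_on {..<n} (\<lambda>i j. S $$ (i, j))"
    using B(4) pd positive_definite_mat_iff_pos_def_on S B(2) by auto
  ultimately show ?thesis using that by blast
qed

text \<open>The cofactor formula for the last diagonal entry of the inverse. It is the determinant
  counterpart of integrating out the last variable, which contributes the factor
  \<open>sqrt (2 * pi / P n n)\<close>.\<close>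

lemma det_mult_inverse_corner:
  fixes s :: "nat \<Rightarrow> nat \<Rightarrow> real"
  assumes "inverse_on {..<Suc n} P s"
  shows "Determinant.det (Matrix.mat (Suc n) (Suc n) (\<lambda>(i, j). s i j)) * P n n =
    Determinant.det (Matrix.mat n n (\<lambda>(i, j). s i j))"
proof -
  let ?N = "Suc n"
  define A where "A = Matrix.mat ?N ?N (\<lambda>(i, j). s i j)"
  define B where "B = Matrix.mat ?N ?N (\<lambda>(i, j). P i j)"
  have A: "A \<in> carrier_mat ?N ?N" and B: "B \<in> carrier_mat ?N ?N" by (simp_all add: A_def B_def)
  have "inverse_on {..<?N} (\<lambda>i j. B $$ (i, j)) (\<lambda>i j. A $$ (i, j))"
    using assms unfolding inverse_on_def by (simp add: A_def B_def)
  then have BA: "B * A = 1\<^sub>m ?N" by (simp only: inverse_on_lessThan_iff[OF A B])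
  note adj = adj_mat[OF A]
  have "adj_mat A = (B * A) * adj_mat A" unfolding BA using adj(1) by simp
  also have "\<dots> = B * (A * adj_mat A)" by (rule assoc_mult_mat[OF B A adj(1)])
  also have "\<dots> = Determinant.det A \<cdot>\<^sub>m B"
    unfolding adj(2) using B by (simp add: mult_smult_distrib[OF B one_carrier_mat])
  finally have "adj_mat A $$ (n, n) = Determinant.det A * P n n"
    by (simp add: B_def)
  moreover have "adj_mat A $$ (n, n) = Determinant.det (mat_delete A n n)"
    using A by (simp add: adj_mat_def cofactor_def)
  moreover have "mat_delete A n n = Matrix.mat n n (\<lambda>(i, j). s i j)"
    by (rule eq_matI) (auto simp: mat_delete_def A_def)
  ultimately show ?thesis by (simp add: A_def)
qed

lemma nn_integral_exp_square:
  assumes "0 < p"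
  shows "(\<integral>\<^sup>+t. ennreal (exp (- (p * t\<^sup>2) / 2)) \<partial>lborel) = ennreal (sqrt (2 * pi / p))"
proof -
  have "(\<integral>\<^sup>+t. ennreal (exp (- (p * t\<^sup>2) / 2)) \<partial>lborel) =
      (\<integral>\<^sup>+t. ennreal (sqrt (2 * pi / p)) * ennreal (normal_density 0 (1 / sqrt p) t) \<partial>lborel)"
    unfolding exp_eq_normal_density[OF assms] using assms by (simp add: ennreal_mult)
  also have "\<dots> = ennreal (sqrt (2 * pi / p)) * (\<integral>\<^sup>+t. ennreal (normal_density 0 (1 / sqrt p) t) \<partial>lborel)"
    by (rule nn_integral_cmult) simp
  also have "(\<integral>\<^sup>+t. ennreal (normal_density 0 (1 / sqrt p) t) \<partial>lborel) = 1"
    using assms by (simp add: nn_integral_eq_integral)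
  finally show ?thesis by simp
qed

text \<open>Both sides are built up one variable at a time: the Schur complement handles the
  remaining integral, and the corner formula relates consecutive leading minors of the fixed
  \<open>s\<close>. Positivity of the minors is part of the induction because it justifies the
  products of square roots.\<close>

lemma nn_integral_gauss_lessThan:
  fixes s :: "nat \<Rightarrow> nat \<Rightarrow> real"
  assumes "pos_def_on {..<n} P" "inverse_on {..<n} P s"
  defines "d \<equiv> Determinant.det (Matrix.mat n n (\<lambda>(i, j). s i j))"
  shows "0 < d \<and> (\<integral>\<^sup>+x. gauss {..<n} P m x \<partial>Pi\<^sub>M {..<n} (\<lambda>_. lborel)) = ennreal (sqrt ((2 * pi) ^ n * d))"
  using assms(1,2) unfolding d_def
proof (induction n arbitrary: P)
  case 0
  show ?case by (simp add: gauss_def quad_def PiM_empty nn_integral_count_space_finite)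
next
  case (Suc n)
  have ins: "{..<Suc n} = insert n {..<n}" by auto
  let ?d = "\<lambda>n. Determinant.det (Matrix.mat n n (\<lambda>(i, j). s i j))"
  have fin: "finite {..<n}" "n \<notin> {..<n}" by auto
  note P = Suc.prems[unfolded ins]
  have pos: "0 < P n n" using pos_def_on_diag[OF P(1), of n] by simp
  have IH: "0 < ?d n" "(\<integral>\<^sup>+x. gauss {..<n} (schur n P) m x \<partial>Pi\<^sub>M {..<n} (\<lambda>_. lborel)) =
      ennreal (sqrt ((2 * pi) ^ n * ?d n))"
    using Suc.IH[OF pos_def_on_schur[OF P(1) fin] inverse_on_schur[OF P(2) fin]] pos by auto
  have d: "?d (Suc n) * P n n = ?d n" by (rule det_mult_inverse_corner[OF Suc.prems(2)])
  with IH(1) pos have d_pos: "0 < ?d (Suc n)" by (metis zero_less_mult_pos2)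
  have "(\<integral>\<^sup>+x. gauss {..<Suc n} P m x \<partial>Pi\<^sub>M {..<Suc n} (\<lambda>_. lborel)) =
      ennreal (sqrt ((2 * pi) ^ n * ?d n)) * ennreal (sqrt (2 * pi / P n n))"
    using nn_integral_gauss_insert[OF fin P(1), of "\<lambda>_. 1" "\<lambda>_. 1" m]
    unfolding ins IH(2)[symmetric] nn_integral_exp_square[OF pos, symmetric] by simp
  also have "\<dots> = ennreal (sqrt (((2 * pi) ^ n * ?d n) * (2 * pi / P n n)))"
    unfolding real_sqrt_mult[of _ "2 * pi / P n n"]
    by (rule ennreal_mult[symmetric]) (use IH(1) pos in auto)
  also have "((2 * pi) ^ n * ?d n) * (2 * pi / P n n) = (2 * pi) ^ Suc n * ?d (Suc n)"
    using pos by (simp add: d[symmetric])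
  finally show ?case using d_pos by blast
qed

text \<open>Here the normalising constant matters: the prescribed density must have total mass 1.
  The vector consists of the coordinate functions on the product space carrying that
  density.\<close>

lemma ex_gaussian_vector:
  assumes m: "m \<in> carrier_vec n" and S: "S \<in> carrier_mat n n" and pd: "positive_definite_mat S"
  shows "\<exists>(M :: (nat \<Rightarrow> real) measure) X. prob_space M \<and> gaussian_vector M n X m S"
proof -
  obtain B where B: "mat_inverse S = Some B" "B \<in> carrier_mat n n" "B * S = 1\<^sub>m n" "positive_definite_mat B"
    using positive_definite_mat_inverse[OF S pd] by metis
  let ?P = "\<lambda>i j. B $$ (i, j)" and ?N = "Pi\<^sub>M {..<n} (\<lambda>_. lborel :: real measure)"
  define d where "d = Determinant.det S"
  have P: "pos_def_on {..<n} ?P" using B(4) positive_definite_mat_iff_pos_def_on[OF B(2)] by simp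
  have inv: "inverse_on {..<n} ?P (\<lambda>i j. S $$ (i, j))"
    using B(3) by (simp add: inverse_on_lessThan_iff[OF S B(2)])
  have "Matrix.mat n n (\<lambda>(i, j). S $$ (i, j)) = S" using S by auto
  with nn_integral_gauss_lessThan[OF P inv, of "\<lambda>i. m $ i"]
  have d: "0 < d" and int: "(\<integral>\<^sup>+x. gauss {..<n} ?P (\<lambda>i. m $ i) x \<partial>?N) = ennreal (sqrt ((2 * pi) ^ n * d))"
    by (auto simp: d_def)
  let ?f = "\<lambda>x. ennreal (mv_normal_density m S (Matrix.vec n x))"
  have f_eq: "?f x = ennreal (1 / sqrt ((2 * pi) ^ n * d)) * gauss {..<n} ?P (\<lambda>i. m $ i) x" for x
    unfolding d_def by (rule mv_normal_density_eq_gauss[OF m B(1,2)])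
  have g: "gauss {..<n} ?P (\<lambda>i. m $ i) \<in> borel_measurable ?N" by (rule gauss_measurable) simp
  have f: "?f \<in> borel_measurable ?N" unfolding f_eq using g by simp
  have "(\<integral>\<^sup>+x. ?f x \<partial>?N) = ennreal (1 / sqrt ((2 * pi) ^ n * d)) * ennreal (sqrt ((2 * pi) ^ n * d))"
    unfolding f_eq using g by (simp add: nn_integral_cmult int)
  also have "\<dots> = ennreal (1 / sqrt ((2 * pi) ^ n * d) * sqrt ((2 * pi) ^ n * d))"
    using d by (intro ennreal_mult[symmetric]) auto
  also have "\<dots> = 1"
    using d by simp
  finally have total: "(\<integral>\<^sup>+x. ?f x \<partial>?N) = 1" .
  define M where "M = density ?N ?f"
  have "prob_space M"
    by (rule prob_spaceI) (simp add: M_def emeasure_density f total cong: nn_integral_cong)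
  moreover have "distributed M ?N (\<lambda>\<omega>. \<lambda>i\<in>{..<n}. \<omega> i) ?f"
  proof (rule distributed_nn_integralI)
    show X: "(\<lambda>\<omega>. \<lambda>i\<in>{..<n}. \<omega> i) \<in> M \<rightarrow>\<^sub>M ?N"
      unfolding M_def by (simp add: measurable_restrict_subset)
    fix A assume A: "A \<in> sets ?N"
    \<comment> \<open>Points of the product space are extensional functions, so restricting them
      changes nothing and the random vector is the identity.\<close>
    have "restrict \<omega> {..<n} = \<omega>" if "\<omega> \<in> space ?N" for \<omega>
      using that by (auto simp: space_PiM PiE_restrict)
    then have "(\<integral>\<^sup>+\<omega>. indicator A (restrict \<omega> {..<n}) \<partial>M) = (\<integral>\<^sup>+\<omega>. indicator A \<omega> \<partial>M)"
      by (intro nn_integral_cong) (simp add: M_def)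
    also have "\<dots> = (\<integral>\<^sup>+x. ?f x * indicator A x \<partial>?N)"
      unfolding M_def using A f by (intro nn_integral_density) auto
    finally show "(\<integral>\<^sup>+\<omega>. indicator A (restrict \<omega> {..<n}) \<partial>M) = (\<integral>\<^sup>+x. ?f x * indicator A x \<partial>?N)" .
  qed (rule f)
  ultimately show ?thesis
    unfolding gaussian_vector_def using m S pd
    by (intro exI[of _ M] exI[of _ "\<lambda>i \<omega>. \<omega> i"]) auto
qed

section \<open>Cyclic constraints\<close>

text \<open>Diagonal dominance: by the inequality between arithmetic and geometric means, the
  off-diagonal terms cost at most \<open>\<epsilon> * card I\<close> times the sum of
  squares.\<close>

lemma pos_def_on_near_identity:
  fixes \<epsilon> :: real
  assumes I: "finite I" and one: "\<And>i. i \<in> I \<Longrightarrow> s i i = 1"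
    and sym: "\<And>i j. i \<in> I \<Longrightarrow> j \<in> I \<Longrightarrow> s i j = s j i"
    and small: "\<And>i j. i \<in> I \<Longrightarrow> j \<in> I \<Longrightarrow> i \<noteq> j \<Longrightarrow> \<bar>s i j\<bar> \<le> \<epsilon>"
    and \<epsilon>: "0 \<le> \<epsilon>" "\<epsilon> * card I < 1"
  shows "pos_def_on I s"
  unfolding pos_def_on_def
proof (intro conjI ballI allI impI)
  fix v :: "'a \<Rightarrow> real" assume v: "\<exists>i\<in>I. v i \<noteq> 0"
  define q where "q = (\<Sum>i\<in>I. (v i)\<^sup>2)"
  have "0 < q" unfolding q_def using v I by (auto intro!: sum_pos2)
  \<comment> \<open>The lower bound subtracts the error term on the diagonal too, which makes the
    double sum uniform and easy to evaluate.\<close>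
  have inner: "(\<Sum>j\<in>I. (if i = j then (v i)\<^sup>2 else 0) - \<epsilon> / 2 * ((v i)\<^sup>2 + (v j)\<^sup>2)) =
      (v i)\<^sup>2 - \<epsilon> / 2 * (card I * (v i)\<^sup>2 + q)" if "i \<in> I" for i
    using I that unfolding sum_subtractf sum_distrib_left[symmetric] sum.distrib q_def by simp
  have "0 < (1 - \<epsilon> * card I) * q" using \<epsilon>(2) \<open>0 < q\<close> by simp
  also have "\<dots> = (\<Sum>i\<in>I. \<Sum>j\<in>I. (if i = j then (v i)\<^sup>2 else 0) - \<epsilon> / 2 * ((v i)\<^sup>2 + (v j)\<^sup>2))"
  proof -
    have "(\<Sum>i\<in>I. (v i)\<^sup>2 - \<epsilon> / 2 * (card I * (v i)\<^sup>2 + q)) = q - \<epsilon> / 2 * (card I * q + card I * q)"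
      unfolding sum_subtractf sum_distrib_left[symmetric] sum.distrib by (simp add: q_def)
    moreover have "(\<Sum>i\<in>I. \<Sum>j\<in>I. (if i = j then (v i)\<^sup>2 else 0) - \<epsilon> / 2 * ((v i)\<^sup>2 + (v j)\<^sup>2)) =
        (\<Sum>i\<in>I. (v i)\<^sup>2 - \<epsilon> / 2 * (card I * (v i)\<^sup>2 + q))"
      by (rule sum.cong[OF refl]) (rule inner)
    ultimately show ?thesis by (simp add: algebra_simps)
  qed
  also have "\<dots> \<le> quad I s v"
    unfolding quad_def
  proof (intro sum_mono)
    fix i j assume ij: "i \<in> I" "j \<in> I"
    show "(if i = j then (v i)\<^sup>2 else 0) - \<epsilon> / 2 * ((v i)\<^sup>2 + (v j)\<^sup>2) \<le> s i j * v i * v j"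
    proof (cases "i = j")
      case True
      then show ?thesis using one[OF ij(1)] \<epsilon>(1) by (simp add: power2_eq_square)
    next
      case False
      have "\<bar>s i j * v i * v j\<bar> = \<bar>s i j\<bar> * \<bar>v i * v j\<bar>" by (simp add: abs_mult mult.assoc)
      also have "\<dots> \<le> \<epsilon> * (((v i)\<^sup>2 + (v j)\<^sup>2) / 2)"
      proof (rule mult_mono)
        have "0 \<le> (\<bar>v i\<bar> - \<bar>v j\<bar>)\<^sup>2" by simp
        then show "\<bar>v i * v j\<bar> \<le> ((v i)\<^sup>2 + (v j)\<^sup>2) / 2"
          by (simp add: power2_diff abs_mult)
      qed (use small[OF ij False] \<epsilon>(1) in auto)
      finally show ?thesis using False by (simp add: abs_le_iff)
    qed
  qed
  finally show "0 < quad I s v" .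
qed (rule sym)

lemma cyclic_self_bound_zero:
  fixes f g :: "nat \<Rightarrow> real"
  assumes f: "\<And>i. i < n \<Longrightarrow> 0 \<le> f i" and g: "\<And>i. i < n \<Longrightarrow> 0 \<le> g i" "\<And>i. i < n \<Longrightarrow> g i < 1"
    and step: "\<And>i. i < n \<Longrightarrow> f i = g i * f ((i + 1) mod n)" and i: "i < n"
  shows "f i = 0"
proof -
  have ne: "finite (f ` {..<n})" "f ` {..<n} \<noteq> {}" using i by auto
  obtain k where k: "k < n" "f k = Max (f ` {..<n})" using Max_in[OF ne] by auto
  have max: "f j \<le> f k" if "j < n" for j
    unfolding k(2) using that by (intro Max_ge) auto
  note k = k(1)
  \<comment> \<open>At a maximum the successor's value is at most \<open>f k\<close>, so
    \<open>f k\<close> is bounded by a factor below 1 times itself.\<close>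
  have "f k \<le> g k * f k"
    unfolding step[OF k] using max[of "(k + 1) mod n"] g(1)[OF k] i k step[OF k] by (simp add: mult_left_mono)
  then have "f k * (1 - g k) \<le> 0" by (simp add: algebra_simps)
  then have "f k \<le> 0" using g(2)[OF k] by (simp add: mult_le_0_iff)
  with max[OF i] f[OF i] show ?thesis by simp
qed

lemma cyclic_covariance_zero:
  fixes s :: "nat \<Rightarrow> nat \<Rightarrow> real"
  assumes n: "3 \<le> n" and s: "pos_def_on {..<n} s"
    and ci: "\<And>i. i < n \<Longrightarrow> s i ((i + 1) mod n) * s ((i + 2) mod n) ((i + 2) mod n) =
      s i ((i + 2) mod n) * s ((i + 1) mod n) ((i + 2) mod n)"
    and i: "i < n"
  shows "s i ((i + 1) mod n) = 0"
proof -
  \<comment> \<open>Squared correlations avoid signs and square roots; squaring the constraint and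
    dividing by the variances turns it into a product formula.\<close>
  define r where "r i j = (s i j)\<^sup>2 / (s i i * s j j)" for i j
  have pos: "0 < s i i" if "i < n" for i
    using pos_def_on_diag[OF s, of i] that by simp
  have r0: "0 \<le> r i j" if "i < n" "j < n" for i j
    using pos that by (simp add: r_def less_imp_le)
  have r1: "r i j < 1" if "i < n" "j < n" "i \<noteq> j" for i j
    using pos_def_on_minor[OF s, of i j] pos that by (simp add: r_def)
  have "r i ((i + 1) mod n) = 0"
  proof (rule cyclic_self_bound_zero[where f = "\<lambda>i. r i ((i + 1) mod n)" and g = "\<lambda>i. r i ((i + 2) mod n)" and n = n])
    fix i assume i: "i < n"
    define j k where "j = (i + 1) mod n" and "k = (i + 2) mod n"
    have jk: "j < n" "k < n" using i by (auto simp: j_def k_def)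
    \<comment> \<open>Since \<open>k\<close> follows \<open>j\<close>, the factor
      \<open>r j k\<close> is the neighbour value at the next index, as the cyclic recursion
      demands.\<close>
    have k: "(j + 1) mod n = k" by (simp add: j_def k_def mod_simps)
    \<comment> \<open>Distinctness, which needs \<open>n\<close> at least 3, makes the squared
      correlation of \<open>i\<close> and \<open>k\<close> strictly less than 1.\<close>
    have ik: "i \<noteq> k" using i n by (auto simp: k_def mod_if)
    show "0 \<le> r i ((i + 1) mod n)" using r0[OF i] jk by (simp add: j_def)
    show "0 \<le> r i ((i + 2) mod n)" "r i ((i + 2) mod n) < 1"
      using r0[OF i jk(2)] r1[OF i jk(2) ik] by (simp_all add: k_def)
    have "s i j * s k k = s i k * s j k"
      using ci[OF i] by (simp add: j_def k_def)
    then have "(s i j)\<^sup>2 * (s k k)\<^sup>2 = (s i k)\<^sup>2 * (s j k)\<^sup>2"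
      by (simp add: power_mult_distrib[symmetric])
    then have "r i j = r i k * r j k"
      using pos[OF i] pos[OF jk(1)] pos[OF jk(2)]
      by (simp add: r_def field_simps power2_eq_square)
    then show "r i ((i + 1) mod n) = r i ((i + 2) mod n) * r ((i + 1) mod n) (((i + 1) mod n + 1) mod n)"
      using k by (simp add: j_def k_def)
  qed (rule i)
  moreover have "s i i \<noteq> 0" "s ((i + 1) mod n) ((i + 1) mod n) \<noteq> 0"
    using pos[OF i] pos[of "(i + 1) mod n"] i by auto
  ultimately show ?thesis by (simp add: r_def)
qed

text \<open>The correlations at distance two are all \<open>\<epsilon>\<close>, and those at distance one are the powers of
  \<open>\<epsilon>\<close> that the constraints force when they are followed backwards from \<open>t\<close>.\<close>

lemma ex_cyclic_covariance:
  fixes n t :: nat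
  assumes n: "4 \<le> n" and t: "t < n"
  obtains s :: "nat \<Rightarrow> nat \<Rightarrow> real" where "pos_def_on {..<n} s"
    "\<And>i. i < n \<Longrightarrow> s i ((i + 1) mod n) \<noteq> 0"
    "\<And>i. i < n \<Longrightarrow> i \<noteq> t \<Longrightarrow> s i ((i + 1) mod n) * s ((i + 2) mod n) ((i + 2) mod n) =
      s i ((i + 2) mod n) * s ((i + 1) mod n) ((i + 2) mod n)"
proof -
  \<comment> \<open>This gives \<open>\<epsilon> * n = 1 / 2\<close>, below the bound 1 that
    diagonal dominance asks for.\<close>
  define \<epsilon> :: real where "\<epsilon> = 1 / (2 * n)"
  \<comment> \<open>The exponent is one more than the number of cyclic steps from \<open>i\<close>
    forward to \<open>t\<close>: it is 1 at \<open>t\<close>, and \<open>n\<close> at the successor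
    of \<open>t\<close>. It drops by one with each step except the step leaving \<open>t\<close>,
    where the constraint is given up.\<close>
  define e where "e i = Suc (if i \<le> t then t - i else t + n - i)" for i
  define s where "s i j = (if i = j then 1
      else if j = (i + 1) mod n then \<epsilon> ^ e i
      else if i = (j + 1) mod n then \<epsilon> ^ e j
      else if j = (i + 2) mod n \<or> i = (j + 2) mod n then \<epsilon> else 0)" for i j
  have \<epsilon>: "0 < \<epsilon>" "\<epsilon> \<le> 1" "\<epsilon> * n < 1" using n by (auto simp: \<epsilon>_def field_simps)
  have succ: "(i + 1) mod n = (if i + 1 = n then 0 else i + 1)" if "i < n" for i
    using that by auto
  have succ2: "(i + 2) mod n = (if i + 2 = n then 0 else if i + 1 = n then 1 else i + 2)" if "i < n" for i
    using that n by (auto simp: mod_if)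
  have s1: "s i ((i + 1) mod n) = \<epsilon> ^ e i" if "i < n" for i
    using that n succ[OF that] by (auto simp: s_def)
  have s2: "s i ((i + 2) mod n) = \<epsilon>" if i: "i < n" for i
  proof -
    define k where "k = (i + 2) mod n"
    have k: "k = (if i + 2 = n then 0 else if i + 1 = n then 1 else i + 2)"
      unfolding k_def by (rule succ2[OF i])
    have "k < n" using i n unfolding k by auto
    then have k1: "(k + 1) mod n = (if k + 1 = n then 0 else k + 1)" by (rule succ)
    have "i \<noteq> k" using i n unfolding k by auto
    moreover have "k \<noteq> (i + 1) mod n" using i n unfolding succ[OF i] k by auto
    \<comment> \<open>The place where \<open>n = 3\<close> would fail: there the index two steps
      ahead is the predecessor, and a distance-two entry would coincide with a neighbour
      entry.\<close>
    moreover have "i \<noteq> (k + 1) mod n" using i n unfolding k1 unfolding k by auto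
    ultimately have "s i k = \<epsilon>" unfolding s_def by (simp add: k_def)
    then show ?thesis by (simp add: k_def)
  qed
  have pow: "\<epsilon> ^ e i \<le> \<epsilon>" "0 \<le> \<epsilon> ^ e i" for i
    using \<epsilon> power_le_one[of \<epsilon>] by (auto simp: e_def mult_left_le)
  have "pos_def_on {..<n} s"
  proof (rule pos_def_on_near_identity[where \<epsilon> = \<epsilon>])
    fix i j assume ij: "i \<in> {..<n}" "j \<in> {..<n}"
    \<comment> \<open>The two neighbour clauses of \<open>s\<close> exclude each other, so
      exchanging \<open>i\<close> and \<open>j\<close> merely swaps them and the order of the cases
      does not break symmetry.\<close>
    have "\<not> (j = (i + 1) mod n \<and> i = (j + 1) mod n)"
      using ij n unfolding succ[of i, OF ij(1)[unfolded lessThan_iff]] succ[of j, OF ij(2)[unfolded lessThan_iff]]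
      by auto
    then show "s i j = s j i" by (auto simp: s_def)
    show "\<bar>s i j\<bar> \<le> \<epsilon>" if "i \<noteq> j" using that \<epsilon> pow by (auto simp: s_def)
  qed (use \<epsilon> in \<open>auto simp: s_def\<close>)
  moreover have "s i ((i + 1) mod n) \<noteq> 0" if "i < n" for i
    using s1[OF that] \<epsilon> by simp
  moreover have "s i ((i + 1) mod n) * s ((i + 2) mod n) ((i + 2) mod n) =
      s i ((i + 2) mod n) * s ((i + 1) mod n) ((i + 2) mod n)" if i: "i < n" "i \<noteq> t" for i
  proof -
    have lt: "(i + 1) mod n < n" using n by simp
    have "((i + 1) mod n + 1) mod n = (i + 2) mod n" by (simp add: mod_simps)
    then have "s ((i + 1) mod n) ((i + 2) mod n) = \<epsilon> ^ e ((i + 1) mod n)"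
      using s1[OF lt] by simp
    \<comment> \<open>Multiplying by the distance-two entry \<open>\<epsilon>\<close> raises the
      exponent by one, which is what the constraint requires; \<open>i \<noteq> t\<close> excludes
      the jump of \<open>e\<close>.\<close>
    moreover have "e i = Suc (e ((i + 1) mod n))"
      using i t unfolding succ[OF i(1)] e_def by auto
    ultimately show ?thesis
      using s1[OF i(1)] s2[OF i(1)] by (simp add: s_def)
  qed
  ultimately show ?thesis using that by blast
qed

theorem theorem1p1:
  fixes n :: nat
  assumes "n \<ge> 4"
  shows "(\<forall>(M :: 'a measure) X m S.
            prob_space M \<longrightarrow> gaussian_vector M n X m S \<longrightarrow>
            (\<forall>i<n. cond_indep_var M (X i) (X ((i + 1) mod n)) (X ((i + 2) mod n))) \<longrightarrow>
            (\<forall>i<n. prob_space.indep_var M borel (X i) borel (X ((i + 1) mod n))))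
       \<and> (\<forall>T. T \<subset> {..<n} \<longrightarrow>
            (\<exists>(M :: (nat \<Rightarrow> real) measure) X m S.
               prob_space M \<and> gaussian_vector M n X m S \<and>
               (\<forall>i\<in>T. cond_indep_var M (X i) (X ((i + 1) mod n)) (X ((i + 2) mod n))) \<and>
               (\<forall>i<n. \<not> prob_space.indep_var M borel (X i) borel (X ((i + 1) mod n)))))"
proof -
  have ne: "(i + 1) mod n < n" "(i + 2) mod n < n" "(i + 2) mod n \<noteq> i"
    "(i + 2) mod n \<noteq> (i + 1) mod n" "i \<noteq> (i + 1) mod n" if "i < n" for i
    using that assms by (auto simp: mod_if)
  show ?thesis
  proof (intro conjI allI impI)
    fix M :: "'a measure" and X m S i
    assume "prob_space M" and X: "gaussian_vector M n X m S" and i: "i < n"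
      and ci: "\<forall>i<n. cond_indep_var M (X i) (X ((i + 1) mod n)) (X ((i + 2) mod n))"
    interpret prob_space M by fact
    obtain P where P: "pos_def_on {..<n} P" "inverse_on {..<n} P (\<lambda>i j. S $$ (i, j))"
      "pos_def_on {..<n} (\<lambda>i j. S $$ (i, j))" "gaussian_on M {..<n} X (\<lambda>i. m $ i) P"
      using gaussian_vector_gaussian_on[OF X] by blast
    have "S $$ (i, (i + 1) mod n) = 0"
    proof (rule cyclic_covariance_zero[OF _ P(3) _ i])
      fix i assume i: "i < n"
      show "S $$ (i, (i + 1) mod n) * S $$ ((i + 2) mod n, (i + 2) mod n) =
          S $$ (i, (i + 2) mod n) * S $$ ((i + 1) mod n, (i + 2) mod n)"
        using cond_indep_var_iff_covariance[OF _ _ _ _ ne(3-5)[OF i] P] ne(1,2)[OF i] i ci by simp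
    qed (use assms in simp)
    then show "indep_var borel (X i) borel (X ((i + 1) mod n))"
      using indep_var_iff_covariance_zero[OF _ _ _ ne(5)[OF i] P] ne(1)[OF i] i by simp
  next
    fix T assume "T \<subset> {..<n}"
    \<comment> \<open>One missing index suffices: the covariance constructed for \<open>t\<close>
      satisfies the constraints at all other indices, hence at all of \<open>T\<close>.\<close>
    then obtain t where t: "t < n" "t \<notin> T" and T: "T \<subseteq> {..<n}" by auto
    obtain s where s: "pos_def_on {..<n} s" "\<And>i. i < n \<Longrightarrow> s i ((i + 1) mod n) \<noteq> 0"
      "\<And>i. i < n \<Longrightarrow> i \<noteq> t \<Longrightarrow> s i ((i + 1) mod n) * s ((i + 2) mod n) ((i + 2) mod n) =
        s i ((i + 2) mod n) * s ((i + 1) mod n) ((i + 2) mod n)"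
      using ex_cyclic_covariance[OF assms t(1)] by metis
    define S where "S = Matrix.mat n n (\<lambda>(i, j). s i j)"
    have S: "S \<in> carrier_mat n n" by (simp add: S_def)
    have entry: "S $$ (i, j) = s i j" if "i < n" "j < n" for i j using that by (simp add: S_def)
    have "quad {..<n} (\<lambda>i j. S $$ (i, j)) v = quad {..<n} s v" for v
      unfolding quad_def by (intro sum.cong) (auto simp: entry)
    then have "pos_def_on {..<n} (\<lambda>i j. S $$ (i, j))"
      using s(1) entry by (simp add: pos_def_on_def)
    then have "positive_definite_mat S" by (simp add: positive_definite_mat_iff_pos_def_on[OF S])
    from ex_gaussian_vector[OF zero_carrier_vec S this]
    obtain M :: "(nat \<Rightarrow> real) measure" and X where "prob_space M" and X: "gaussian_vector M n X (0\<^sub>v n) S"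
      by blast
    interpret prob_space M by fact
    obtain P where P: "pos_def_on {..<n} P" "inverse_on {..<n} P (\<lambda>i j. S $$ (i, j))"
      "pos_def_on {..<n} (\<lambda>i j. S $$ (i, j))" "gaussian_on M {..<n} X (\<lambda>i. 0\<^sub>v n $ i) P"
      using gaussian_vector_gaussian_on[OF X] by blast
    have "\<forall>i\<in>T. cond_indep_var M (X i) (X ((i + 1) mod n)) (X ((i + 2) mod n))"
    proof
      fix i assume "i \<in> T"
      then have i: "i < n" "i \<noteq> t" using T t by auto
      show "cond_indep_var M (X i) (X ((i + 1) mod n)) (X ((i + 2) mod n))"
        using cond_indep_var_iff_covariance[OF _ _ _ _ ne(3-5)[OF i(1)] P] ne(1,2)[OF i(1)] i s(3)[OF i]
        by (simp add: entry)
    qed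
    moreover have "\<forall>i<n. \<not> indep_var borel (X i) borel (X ((i + 1) mod n))"
      using indep_var_iff_covariance_zero[OF _ _ _ ne(5) P] ne(1) s(2) by (simp add: entry)
    ultimately show "\<exists>(M :: (nat \<Rightarrow> real) measure) X m S.
               prob_space M \<and> gaussian_vector M n X m S \<and>
               (\<forall>i\<in>T. cond_indep_var M (X i) (X ((i + 1) mod n)) (X ((i + 2) mod n))) \<and>
               (\<forall>i<n. \<not> prob_space.indep_var M borel (X i) borel (X ((i + 1) mod n)))"
      using X prob_space_axioms by blast
  qed
qed

end
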